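(* Let $d\ge 1$. For each $K>0$ there exists a constant $C<\infty$ such that for every field $\alpha=(\alpha_x)_{x\in\mathbb{Z}^d}$ with $-K\le\alpha_x\le K$ for all $x$, every box $\Lambda_L\subset\mathbb{Z}^d$ of side length $L$, every integer $0\le N\le L^d$, and every function $f:\{0,1\}^{\Lambda_L}\to\mathbb{R}$, $$E_{\mu_{\Lambda_L,N}}\big[(f-E_{\mu_{\Lambda_L,N}}[f])^2\big]\le C\,L^2\,D_{Kaw}(\Lambda_L,N;f).$$
   Context: A box of side length $L$ (a positive integer) is a set $\Lambda_L=\{x\in\mathbb{Z}^d: x_i-y_i\in\{0,1,\dots,L-1\},\ i=1,\dots,d\}$ for some $y=(y_1,\dots,y_d)\in\mathbb{Z}^d$. For a finite $\Lambda\subset\mathbb{Z}^d$ and a field $\alpha$, put $p_x=e^{\alpha_x}/(1+e^{\alpha_x})$. The inhomogeneous Bernoulli measure on $\{0,1\}^\Lambda$ is the product probability measure $\mu_{\Lambda}(\eta)=\prod_{x\in\Lambda}p_x^{\eta_x}(1-p_x)^{1-\eta_x}$. Conditioned to have $N$ particles it is $\mu_{\Lambda,N}(\eta)=\mu_{\Lambda}(\eta\mid\sum_{x\in\Lambda}\eta_x=N)$; that is, $\mu_{\Lambda,N}(\eta)$ is proportional to $\exp\{\sum_{x\in\Lambda}\alpha_x\eta_x\}$ on configurations with exactly $N$ particles and is zero on all others. $E_\mu$ denotes expectation with respect to $\mu$. $T_{x,y}\eta$ is the configuration obtained from $\eta$ by exchanging the values $\eta_x$ and $\eta_y$ and leaving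 all other values unchanged. The Kawasaki Dirichlet form is $$D_{Kaw}(\Lambda,N;f)=E_{\mu_{\Lambda,N}}\Big[\sum_{x,y\in\Lambda,\ x\sim y}(f(T_{x,y}\eta)-f(\eta))^2\Big],$$ where $x\sim y$ means that $x$ and $y$ are nearest neighbours in $\mathbb{Z}^d$. *)

theory Defs
  imports "HOL-Probability.Probability"
begin

definition lattice_box :: "(int ^ 'd) \<Rightarrow> nat \<Rightarrow> (int ^ 'd) set" where
  "lattice_box y L = {x. \<forall>i. x $ i - y $ i \<in> {0..int L - 1}}"

definition nearest_neighbours :: "(int ^ 'd) \<Rightarrow> (int ^ 'd) \<Rightarrow> bool" where
  "nearest_neighbours x y \<longleftrightarrow> (\<Sum>i\<in>UNIV. \<bar>x $ i - y $ i\<bar>) = 1"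

text \<open>
  A configuration in \<open>{0,1}\<^sup>\<Lambda>\<close> is a function from sites to \<^typ>\<open>bool\<close>
  (\<^const>\<open>True\<close> meaning an occupied site) that is \<^const>\<open>False\<close> outside \<open>\<Lambda>\<close>;
  these configurations are exactly the support of \<open>bernoulli_field\<close> below.
\<close>

definition num_particles :: "(int ^ 'd) set \<Rightarrow> (int ^ 'd \<Rightarrow> bool) \<Rightarrow> nat" where
  "num_particles \<Lambda> \<eta> = (\<Sum>x\<in>\<Lambda>. of_bool (\<eta> x))"

definition bernoulli_field ::
    "(int ^ 'd \<Rightarrow> real) \<Rightarrow> (int ^ 'd) set \<Rightarrow> (int ^ 'd \<Rightarrow> bool) pmf" where
  "bernoulli_field \<alpha> \<Lambda> =
     Pi_pmf \<Lambda> False (\<lambda>x. bernoulli_pmf (exp (\<alpha> x) / (1 + exp (\<alpha> x))))"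

text \<open>
  The conditioning is meaningful exactly when the conditioning event has positive probability;
  see \<open>canonical_conditioning_nonempty\<close>.
\<close>

definition canonical ::
    "(int ^ 'd \<Rightarrow> real) \<Rightarrow> (int ^ 'd) set \<Rightarrow> nat \<Rightarrow> (int ^ 'd \<Rightarrow> bool) pmf" where
  "canonical \<alpha> \<Lambda> N = cond_pmf (bernoulli_field \<alpha> \<Lambda>) {\<eta>. num_particles \<Lambda> \<eta> = N}"

definition exchange :: "'a \<Rightarrow> 'a \<Rightarrow> ('a \<Rightarrow> bool) \<Rightarrow> ('a \<Rightarrow> bool)" where
  "exchange x y \<eta> = \<eta>(x := \<eta> y, y := \<eta> x)"

text \<open>The sum runs over ordered pairs, so each bond of \<open>\<Lambda>\<close> is counted twice.\<close>

definition kawasaki_form ::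
    "(int ^ 'd \<Rightarrow> real) \<Rightarrow> (int ^ 'd) set \<Rightarrow> nat \<Rightarrow> ((int ^ 'd \<Rightarrow> bool) \<Rightarrow> real) \<Rightarrow> real" where
  "kawasaki_form \<alpha> \<Lambda> N f =
     measure_pmf.expectation (canonical \<alpha> \<Lambda> N)
       (\<lambda>\<eta>. \<Sum>(x, y) | x \<in> \<Lambda> \<and> y \<in> \<Lambda> \<and> nearest_neighbours x y.
               (f (exchange x y \<eta>) - f \<eta>)\<^sup>2)"

lemma set_bernoulli_field:
  assumes "finite \<Lambda>"
  shows "set_pmf (bernoulli_field \<alpha> \<Lambda>) = {\<eta>. \<forall>x. x \<notin> \<Lambda> \<longrightarrow> \<not> \<eta> x}"
proof -
  have p: "0 < exp (\<alpha> x) / (1 + exp (\<alpha> x))" "exp (\<alpha> x) / (1 + exp (\<alpha> x)) < 1" for x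
    by (simp_all add: add_pos_pos)
  have "set_pmf (bernoulli_pmf (exp (\<alpha> x) / (1 + exp (\<alpha> x)))) = UNIV" for x
    using p[of x] by (rule set_pmf_bernoulli)
  then show ?thesis
    unfolding bernoulli_field_def using assms
    by (auto simp: set_Pi_pmf PiE_dflt_def)
qed

lemma canonical_conditioning_nonempty:
  assumes "finite \<Lambda>" "N \<le> card \<Lambda>"
  shows "set_pmf (bernoulli_field \<alpha> \<Lambda>) \<inter> {\<eta>. num_particles \<Lambda> \<eta> = N} \<noteq> {}"
proof -
  obtain A where A: "A \<subseteq> \<Lambda>" "card A = N"
    using assms(2) obtain_subset_with_card_n by blast
  have "num_particles \<Lambda> (\<lambda>x. x \<in> A) = N"
    using assms(1) A by (simp add: num_particles_def sum.If_cases of_bool_def Int_absorb1)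
  moreover have "(\<lambda>x. x \<in> A) \<in> set_pmf (bernoulli_field \<alpha> \<Lambda>)"
    using A(1) by (auto simp: set_bernoulli_field[OF assms(1)])
  ultimately show ?thesis by blast
qed

lemma
  fixes y :: "int ^ 'd"
  shows finite_lattice_box: "finite (lattice_box y L)" and card_lattice_box: "card (lattice_box y L) = L ^ CARD('d)"
proof -
  let ?P = "Pi\<^sub>E (UNIV :: 'd set) (\<lambda>i. {y $ i..y $ i + int L - 1})"
  have "bij_betw (($) :: int ^ 'd \<Rightarrow> 'd \<Rightarrow> int) (lattice_box y L) ?P"
    by (rule bij_betwI[where g = vec_lambda])
       (auto simp: lattice_box_def PiE_iff algebra_simps)
  moreover have "finite ?P" by (intro finite_PiE) auto
  moreover have "card ?P = L ^ CARD('d)" by (simp add: card_PiE)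
  ultimately show "finite (lattice_box y L)" "card (lattice_box y L) = L ^ CARD('d)"
    by (auto simp: bij_betw_finite bij_betw_same_card)
qed

end

theory Submission
  imports Defs
begin

text \<open>
  A configuration is encoded as its set \<open>A\<close> of occupied sites, with weight \<open>\<Prod>x\<in>A. r x\<close>
  where \<open>r x = exp (\<alpha> x)\<close>.

  Long-range exchanges: let a particle jump to each empty site \<open>y\<close> at rate \<open>r y\<close>. Coupling two
  copies that differ by one particle shows that this reversible dynamics contracts the Lipschitz
  seminorm at rate at least \<open>|\<Lambda>| \<cdot> min r\<close>, whatever the number of particles; for a reversible
  dynamics the contraction passes to \<open>L\<^sup>2\<close>, because \<open>t \<mapsto> \<parallel>P\<^sup>t f\<parallel>\<^sup>2\<close> is log-convex. Hence the
  variance is at most a constant times \<open>|\<Lambda>|\<^sup>-\<^sup>1\<close> times the sum of all exchange energies.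

  Moving particles: the usual decomposition of an exchange along a path distorts the weight
  exponentially in the length of the path. Instead the path is split recursively at the interior
  site where \<open>r\<close> is largest, the endpoints having been given the maximal weight first. Then
  no intermediate configuration loses weight, every bond is used exactly once, and the weights
  in Cauchy--Schwarz can be chosen so that the cost is linear in the length.
\<close>

section \<open>Abstract spectral gap: from contraction of a seminorm to contraction in weighted
  \<open>L^2\<close>\<close>

lemma weighted_Cauchy_Schwarz:
  fixes \<pi> f g :: "'a \<Rightarrow> real"
  assumes "\<And>A. A \<in> S \<Longrightarrow> 0 \<le> \<pi> A"
  shows "(\<Sum>A\<in>S. \<pi> A * (f A * g A))\<^sup>2 \<le> (\<Sum>A\<in>S. \<pi> A * (f A)\<^sup>2) * (\<Sum>A\<in>S. \<pi> A * (g A)\<^sup>2)"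
proof -
  have "(\<Sum>A\<in>S. \<pi> A * (f A * g A)) = (\<Sum>A\<in>S. (sqrt (\<pi> A) * f A) * (sqrt (\<pi> A) * g A))"
    by (intro sum.cong) (use assms in \<open>auto simp: algebra_simps simp flip: power2_eq_square\<close>)
  moreover have "(\<Sum>A\<in>S. \<pi> A * (h A)\<^sup>2) = (\<Sum>A\<in>S. (sqrt (\<pi> A) * h A)\<^sup>2)" for h :: "'a \<Rightarrow> real"
    by (intro sum.cong) (use assms in \<open>auto simp: power_mult_distrib\<close>)
  ultimately show ?thesis
    using Cauchy_Schwarz_ineq_sum[of "\<lambda>A. sqrt (\<pi> A) * f A" "\<lambda>A. sqrt (\<pi> A) * g A" S] by simp
qed

text \<open>Log-convexity makes the ratios \<open>b (Suc t) / b t\<close> nondecreasing. If the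
  first one exceeded \<open>q\<close>, then \<open>b\<close> would grow at least like a power of
  that larger ratio and overtake \<open>c * q ^ t\<close>. However large \<open>c\<close> is, it
  disappears from the conclusion.\<close>

lemma log_convex_geometric_bound:
  fixes b :: "nat \<Rightarrow> real"
  assumes nonneg: "\<And>t. 0 \<le> b t"
    and logconv: "\<And>t. (b (Suc t))\<^sup>2 \<le> b t * b (Suc (Suc t))"
    and bound: "\<And>t. b t \<le> c * q ^ t" and "0 < q"
  shows "b 1 \<le> q * b 0"
proof (rule ccontr)
  assume "\<not> b 1 \<le> q * b 0"
  then have gt: "q * b 0 < b 1" by simp
  have "b 0 > 0"
  proof (rule ccontr)
    assume "\<not> b 0 > 0"
    then have "b 0 = 0" using nonneg[of 0] by simp
    with logconv[of 0] have "b 1 = 0" by simp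
    with gt \<open>b 0 = 0\<close> show False by simp
  qed
  define s where "s = b 1 / b 0"
  have s: "s > q" using gt \<open>b 0 > 0\<close> by (simp add: s_def field_simps)
  then have s0: "s > 0" using \<open>0 < q\<close> by simp
  have step: "b t > 0 \<and> s * b t \<le> b (Suc t)" for t
  proof (induction t)
    case 0
    then show ?case using \<open>b 0 > 0\<close> by (simp add: s_def)
  next
    case (Suc t)
    have pos: "b (Suc t) > 0" using Suc s0 by (smt (verit) mult_pos_pos)
    have "s * b (Suc t) * b t \<le> b (Suc t) * b (Suc t)"
      using Suc pos by (simp add: mult.assoc mult.commute mult_left_mono)
    also have "\<dots> \<le> b (Suc (Suc t)) * b t"
      using logconv[of t] by (simp add: power2_eq_square mult.commute)
    finally show ?case using Suc pos by simp
  qed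
  have lower: "s ^ t * b 0 \<le> b t" for t
  proof (induction t)
    case (Suc t)
    then have "s * (s ^ t * b 0) \<le> s * b t" using s0 by simp
    also have "\<dots> \<le> b (Suc t)" using step by blast
    finally show ?case by (simp add: mult.assoc)
  qed simp
  obtain t where t: "c / b 0 < (s / q) ^ t"
    using real_arch_pow[of "s / q" "c / b 0"] s \<open>0 < q\<close> by auto
  have "(s / q) ^ t * b 0 * q ^ t \<le> c * q ^ t"
    using order_trans[OF lower bound, of t] \<open>0 < q\<close> by (simp add: power_divide)
  then have "(s / q) ^ t * b 0 \<le> c" using \<open>0 < q\<close> by simp
  with t \<open>b 0 > 0\<close> show False by (simp add: field_simps)
qed

text \<open>\<open>Lip f d\<close> stands for any seminorm bound that \<open>P\<close> contracts by
  \<open>\<rho>\<close>. With \<open>b t\<close> the squared norm of \<open>(P ^^ t) f\<close>,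
  reversibility and Cauchy--Schwarz make \<open>b\<close> log-convex, while the seminorm gives decay
  like \<open>\<rho> ^ (2 * t)\<close> with a crude constant. Log-convexity removes that constant,
  and a last Cauchy--Schwarz bounds the form of \<open>P\<close> at \<open>f\<close>.\<close>

lemma reversible_contraction:
  fixes P :: "('a \<Rightarrow> real) \<Rightarrow> 'a \<Rightarrow> real" and \<pi> :: "'a \<Rightarrow> real"
    and Lip :: "('a \<Rightarrow> real) \<Rightarrow> real \<Rightarrow> bool"
  assumes fin: "finite S" and pos: "\<And>A. A \<in> S \<Longrightarrow> 0 < \<pi> A" and "0 < \<rho>"
    and sym: "\<And>f g. (\<Sum>A\<in>S. \<pi> A * (f A * P g A)) = (\<Sum>A\<in>S. \<pi> A * (P f A * g A))"
    and mean: "\<And>f. (\<Sum>A\<in>S. \<pi> A * P f A) = (\<Sum>A\<in>S. \<pi> A * f A)"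
    and contract: "\<And>f d. Lip f d \<Longrightarrow> Lip (P f) (\<rho> * d)"
    and osc: "\<And>f d A B. Lip f d \<Longrightarrow> A \<in> S \<Longrightarrow> B \<in> S \<Longrightarrow> \<bar>f A - f B\<bar> \<le> D * d"
    and Lip0: "Lip f d"
    and mean0: "(\<Sum>A\<in>S. \<pi> A * f A) = 0"
  shows "(\<Sum>A\<in>S. \<pi> A * (f A * P f A)) \<le> \<rho> * (\<Sum>A\<in>S. \<pi> A * (f A)\<^sup>2)"
proof -
  define g where "g = (\<lambda>t. (P ^^ t) f)"
  define b where "b = (\<lambda>t. \<Sum>A\<in>S. \<pi> A * (g t A)\<^sup>2)"
  have gSuc: "g (Suc t) = P (g t)" for t by (simp add: g_def)
  have nonneg: "0 \<le> b t" for t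
    unfolding b_def using pos by (intro sum_nonneg mult_nonneg_nonneg) (auto intro: less_imp_le)
  have CS: "(\<Sum>A\<in>S. \<pi> A * (u A * v A))\<^sup>2 \<le> (\<Sum>A\<in>S. \<pi> A * (u A)\<^sup>2) * (\<Sum>A\<in>S. \<pi> A * (v A)\<^sup>2)" for u v
    using pos by (intro weighted_Cauchy_Schwarz) (auto intro: less_imp_le)
  have logconv: "(b (Suc t))\<^sup>2 \<le> b t * b (Suc (Suc t))" for t
  proof -
    have "b (Suc t) = (\<Sum>A\<in>S. \<pi> A * (P (g t) A * g (Suc t) A))"
      by (simp add: b_def gSuc power2_eq_square)
    also have "\<dots> = (\<Sum>A\<in>S. \<pi> A * (g t A * g (Suc (Suc t)) A))"
      unfolding gSuc[of "Suc t"] by (rule sym[symmetric])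
    finally show ?thesis using CS[of "g t" "g (Suc (Suc t))"] by (simp add: b_def)
  qed
  have Lipg: "Lip (g t) (\<rho> ^ t * d)" for t
  proof (induction t)
    case 0 then show ?case using Lip0 by (simp add: g_def)
  next
    case (Suc t) then show ?case using contract[OF Suc] by (simp add: gSuc mult.assoc)
  qed
  have mean_g: "(\<Sum>A\<in>S. \<pi> A * g t A) = 0" for t
    by (induction t) (use mean0 mean in \<open>auto simp: gSuc g_def\<close>)
  define Z where "Z = sum \<pi> S"
  \<comment> \<open>Since \<open>g t\<close> has weighted mean zero, \<open>Z * g t A\<close> is a
    weighted sum of differences \<open>g t A - g t B\<close>, each controlled by the
    oscillation.\<close>
  have sup: "(g t A)\<^sup>2 \<le> (D * d)\<^sup>2 * (\<rho>\<^sup>2) ^ t" if A: "A \<in> S" for t A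
  proof -
    have Z: "Z > 0" unfolding Z_def using A fin pos by (intro sum_pos) auto
    have "Z * g t A = (\<Sum>B\<in>S. \<pi> B * (g t A - g t B))"
      using mean_g[of t] by (simp add: Z_def sum_distrib_right right_diff_distrib sum_subtractf)
    then have "Z * \<bar>g t A\<bar> = \<bar>\<Sum>B\<in>S. \<pi> B * (g t A - g t B)\<bar>"
      using Z by (simp add: abs_mult flip: \<open>Z * g t A = _\<close>)
    also have "\<dots> \<le> (\<Sum>B\<in>S. \<bar>\<pi> B * (g t A - g t B)\<bar>)" by (rule sum_abs)
    also have "\<dots> \<le> (\<Sum>B\<in>S. \<pi> B * (D * (\<rho> ^ t * d)))"
      using pos osc[OF Lipg A]
      by (intro sum_mono) (simp add: abs_mult abs_of_pos mult_left_mono less_imp_le)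
    also have "\<dots> = Z * (D * (\<rho> ^ t * d))" by (simp add: Z_def sum_distrib_right)
    finally have "\<bar>g t A\<bar> \<le> D * (\<rho> ^ t * d)" using Z by simp
    then have "\<bar>g t A\<bar>\<^sup>2 \<le> (D * (\<rho> ^ t * d))\<^sup>2" by (intro power_mono) auto
    then show ?thesis by (simp add: power_mult_distrib power_even_eq mult_ac flip: power_mult)
  qed
  have bound: "b t \<le> (Z * (D * d)\<^sup>2) * (\<rho>\<^sup>2) ^ t" for t
  proof -
    have "b t \<le> (\<Sum>A\<in>S. \<pi> A * ((D * d)\<^sup>2 * (\<rho>\<^sup>2) ^ t))"
      unfolding b_def using pos sup by (intro sum_mono mult_left_mono) (auto intro: less_imp_le)
    then show ?thesis by (simp add: Z_def sum_distrib_right mult.assoc)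
  qed
  have "b 1 \<le> \<rho>\<^sup>2 * b 0"
    using \<open>0 < \<rho>\<close> by (intro log_convex_geometric_bound[OF nonneg logconv bound]) auto
  then have "b 0 * b 1 \<le> b 0 * (\<rho>\<^sup>2 * b 0)" using nonneg by (intro mult_left_mono)
  also have "\<dots> = (\<rho> * b 0)\<^sup>2" by (simp add: power2_eq_square)
  finally have "(\<Sum>A\<in>S. \<pi> A * (g 0 A * g 1 A))\<^sup>2 \<le> (\<rho> * b 0)\<^sup>2"
    using CS[of "g 0" "g 1"] unfolding b_def by linarith
  then have "(\<Sum>A\<in>S. \<pi> A * (g 0 A * g 1 A)) \<le> \<rho> * b 0"
    by (rule power2_le_imp_le) (use \<open>0 < \<rho>\<close> nonneg in auto)
  then show ?thesis by (simp add: g_def b_def)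
qed

section \<open>Configurations as particle sets, single-particle jumps and detailed balance\<close>

definition slice :: "'a set \<Rightarrow> nat \<Rightarrow> 'a set set" where
  "slice V N = {A. A \<subseteq> V \<and> card A = N}"

text \<open>\<open>T\<close> is the set of particles away from \<open>x\<close> and
  \<open>y\<close>. The weights at \<open>x\<close> and \<open>y\<close> do not enter, so these two
  may be changed freely. All particle numbers occur; a single level is selected by an
  \<open>F\<close> that vanishes on the others.\<close>

definition exchange_energy :: "('a \<Rightarrow> real) \<Rightarrow> 'a set \<Rightarrow> ('a set \<Rightarrow> real) \<Rightarrow> 'a \<Rightarrow> 'a \<Rightarrow> real" where
  "exchange_energy r V F x y = (\<Sum>T\<in>Pow (V - {x, y}). prod r T * (F (insert x T) - F (insert y T))\<^sup>2)"

definition swaps :: "'a set \<Rightarrow> nat \<Rightarrow> ('a set \<times> 'a \<times> 'a) set" where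
  "swaps V N = Sigma (slice V N) (\<lambda>A. A \<times> (V - A))"

text \<open>Lipschitz bound for the graph on the slice whose edges move one particle;
  \<open>T\<close> is the common part of two neighbours. As \<open>x = y\<close> is allowed,
  \<open>d\<close> is nonnegative as soon as the slice contains a nonempty set.\<close>

definition slice_Lipschitz :: "'a set \<Rightarrow> nat \<Rightarrow> ('a set \<Rightarrow> real) \<Rightarrow> real \<Rightarrow> bool" where
  "slice_Lipschitz V N F d \<longleftrightarrow>
     (\<forall>T x y. insert x T \<in> slice V N \<longrightarrow> insert y T \<in> slice V N \<longrightarrow> x \<notin> T \<longrightarrow> y \<notin> T \<longrightarrow>
        \<bar>F (insert x T) - F (insert y T)\<bar> \<le> d)"

lemma finite_slice: "finite V \<Longrightarrow> finite (slice V N)"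
  by (rule finite_subset[of _ "Pow V"]) (auto simp: slice_def)

lemma swap_in_slice:
  assumes "finite V" "A \<in> slice V N" "x \<in> A" "y \<in> V - A"
  shows "insert y (A - {x}) \<in> slice V N"
proof -
  have "finite A" using assms by (auto simp: slice_def intro: finite_subset)
  then have "card (insert y (A - {x})) = card A"
    using assms card_Suc_Diff1[of A x] by simp
  then show ?thesis using assms by (auto simp: slice_def)
qed

lemma swaps_reverse:
  assumes "finite V"
  shows "(\<Sum>(A, x, y)\<in>swaps V N. h A x y) = (\<Sum>(A, x, y)\<in>swaps V N. h (insert y (A - {x})) y x)"
proof -
  let ?i = "\<lambda>(A, x, y). (insert y (A - {x}), y, x)"
  have "?i s \<in> swaps V N" "?i (?i s) = s" if "s \<in> swaps V N" for s
    using that swap_in_slice[OF assms] by (auto simp: swaps_def slice_def insert_absorb)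
  then show ?thesis
    by (intro sum.reindex_bij_witness[where i = ?i and j = ?i]) (auto simp: insert_absorb swaps_def)
qed

text \<open>Detailed balance: the jump to \<open>y\<close> has rate \<open>r y\<close>, the reverse
  jump to \<open>x\<close> has rate \<open>r x\<close>.\<close>

lemma swap_weight:
  fixes r :: "'a \<Rightarrow> real"
  assumes "finite A" "x \<in> A" "y \<notin> A"
  shows "prod r (insert y (A - {x})) * r x = prod r A * r y"
  using assms by (simp add: prod.remove[of A x] mult_ac)

lemma swaps_weighted_reverse:
  fixes r :: "'a \<Rightarrow> real"
  assumes "finite V"
  shows "(\<Sum>(A, x, y)\<in>swaps V N. prod r A * r y * h A (insert y (A - {x}))) =
         (\<Sum>(A, x, y)\<in>swaps V N. prod r A * r y * h (insert y (A - {x})) A)"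
proof (subst swaps_reverse[OF assms], intro sum.cong refl, clarify)
  fix A x y assume A: "(A, x, y) \<in> swaps V N"
  then have "finite A" using assms by (auto simp: swaps_def slice_def intro: finite_subset)
  moreover have "insert x (insert y (A - {x}) - {y}) = A" using A by (auto simp: swaps_def)
  ultimately show "prod r (insert y (A - {x})) * r x *
      h (insert y (A - {x})) (insert x (insert y (A - {x}) - {y})) =
      prod r A * r y * h (insert y (A - {x})) A"
    using swap_weight[of A x y r] A by (simp add: swaps_def)
qed

text \<open>A jump is recorded by \<open>x\<close>, \<open>y\<close> and the particles
  \<open>T = A - {x}\<close> that stay; its factor \<open>prod r A * r y\<close> becomes
  \<open>r x * r y * prod r T\<close>. This expresses the Dirichlet form of the long-range dynamics
  by exchange energies.\<close>

lemma sum_swaps_by_pairs: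
  fixes r :: "'a \<Rightarrow> real"
  assumes "finite V" and supp: "\<And>A. card A \<noteq> N \<Longrightarrow> F A = 0"
  shows "(\<Sum>(A, x, y)\<in>swaps V N. prod r A * r y * (F (insert y (A - {x})) - F A)\<^sup>2) =
         (\<Sum>x\<in>V. \<Sum>y\<in>V. r x * r y * exchange_energy r V F x y)"
proof -
  let ?D = "{(x, y). x \<in> V \<and> y \<in> V \<and> x \<noteq> y}"
  let ?g = "\<lambda>(p, T). r (fst p) * r (snd p) * (prod r T * (F (insert (fst p) T) - F (insert (snd p) T))\<^sup>2)"
  have finD: "finite ?D" by (rule finite_subset[of _ "V \<times> V"]) (use assms in auto)
  let ?X = "Sigma ?D (\<lambda>p. Pow (V - {fst p, snd p}))"
  have finX: "finite ?X" using finD assms by (intro finite_SigmaI) auto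
  have "(\<Sum>x\<in>V. \<Sum>y\<in>V. r x * r y * exchange_energy r V F x y) =
        (\<Sum>p\<in>V \<times> V. r (fst p) * r (snd p) * exchange_energy r V F (fst p) (snd p))"
    by (simp add: sum.cartesian_product case_prod_unfold)
  also have "\<dots> = (\<Sum>p\<in>?D. r (fst p) * r (snd p) * exchange_energy r V F (fst p) (snd p))"
    using assms by (intro sum.mono_neutral_right) (auto simp: exchange_energy_def)
  also have "\<dots> = sum ?g ?X"
    using finD assms unfolding exchange_energy_def sum_distrib_left
    by (subst sum.Sigma) (auto simp: case_prod_unfold)
  \<comment> \<open>For \<open>T\<close> of the wrong size, \<open>F\<close> vanishes on both
    one-point extensions.\<close>
  also have "\<dots> = sum ?g {s \<in> ?X. card (snd s) + 1 = N}"
  proof (rule sum.mono_neutral_right[OF finX])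
    show "\<forall>s\<in>?X - {s \<in> ?X. card (snd s) + 1 = N}. ?g s = 0"
    proof
      fix s assume "s \<in> ?X - {s \<in> ?X. card (snd s) + 1 = N}"
      then obtain x y T where s: "s = ((x, y), T)" "T \<subseteq> V - {x, y}" "card T + 1 \<noteq> N"
        by auto
      then have "finite T" using assms by (auto intro: finite_subset)
      with s have "card (insert x T) \<noteq> N" "card (insert y T) \<noteq> N"
        by (auto simp: card_insert_if subset_iff)
      then show "?g s = 0" using s(1) by (simp add: supp)
    qed
  qed auto
  also have "\<dots> = (\<Sum>(A, x, y)\<in>swaps V N. prod r A * r y * (F (insert y (A - {x})) - F A)\<^sup>2)"
  proof (rule sum.reindex_bij_witness[where i = "\<lambda>(A, x, y). ((x, y), A - {x})" and
        j = "\<lambda>((x, y), T). (insert x T, x, y)"], goal_cases)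
    case (1 s)
    then show ?case by force
  next
    case (2 s)
    then obtain x y T where s: "s = ((x, y), T)" "x \<in> V" "y \<in> V" "x \<noteq> y" "T \<subseteq> V - {x, y}" "card T + 1 = N"
      by auto
    then have "finite T" "x \<notin> T" using assms by (auto intro: finite_subset)
    with s show ?case by (auto simp: swaps_def slice_def)
  next
    case (3 s)
    then show ?case by (auto simp: swaps_def insert_absorb)
  next
    case (4 s)
    then obtain A x y where s: "s = (A, x, y)" "A \<subseteq> V" "card A = N" "x \<in> A" "y \<in> V" "y \<notin> A"
      by (auto simp: swaps_def slice_def)
    then have "finite A" using assms by (auto intro: finite_subset)
    then have "card (A - {x}) + 1 = N" using s card_Suc_Diff1[of A x] by simp
    with s show ?case by auto
  next
    case (5 s)
    then obtain x y T where s: "s = ((x, y), T)" "x \<in> V" "y \<in> V" "x \<noteq> y" "T \<subseteq> V - {x, y}"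
      by auto
    then have "finite T" "x \<notin> T" using assms by (auto intro: finite_subset)
    with s show ?case by (simp add: power2_commute mult_ac)
  qed
  finally show ?thesis by simp
qed

section \<open>Coupling contraction and Poincare inequality for long-range exchanges\<close>

text \<open>Both sets have equally many particles, so while \<open>A - B\<close> is nonempty one of
  its particles can be moved to a site of \<open>B - A\<close>, at cost at most
  \<open>d\<close>.\<close>

lemma slice_Lipschitz_oscillation:
  fixes d :: real
  assumes "finite V" and Lip: "slice_Lipschitz V N F d" and "0 \<le> d"
    and "A \<in> slice V N" "B \<in> slice V N"
  shows "\<bar>F A - F B\<bar> \<le> real (card (A - B)) * d"
  using assms(4)
proof (induction "card (A - B)" arbitrary: A)
  case 0
  have fin: "finite A" "finite B" using 0 assms by (auto simp: slice_def intro: finite_subset)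
  then have "A \<subseteq> B" using 0 by auto
  then have "A = B" using 0 assms fin by (auto simp: slice_def card_subset_eq)
  then show ?case by simp
next
  case (Suc k)
  have fin: "finite A" "finite B" using Suc assms by (auto simp: slice_def intro: finite_subset)
  have "card (B - A) = card (A - B)"
    using fin Suc assms by (auto simp: slice_def card_le_sym_Diff intro!: antisym)
  then obtain x y where xy: "x \<in> A" "x \<notin> B" "y \<in> B" "y \<notin> A"
    using Suc(2) by (metis DiffE card.empty equals0I nat.distinct(1))
  define A' where "A' = insert y (A - {x})"
  have A': "A' \<in> slice V N"
    unfolding A'_def using xy Suc assms by (intro swap_in_slice) (auto simp: slice_def)
  have "A' - B = (A - B) - {x}" using xy by (auto simp: A'_def)
  then have "k = card (A' - B)" using Suc(2) xy fin by (simp add: card_Diff_singleton)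
  then have IH: "\<bar>F A' - F B\<bar> \<le> k * d" using Suc(1) A' by blast
  have "insert x (A - {x}) = A" using xy by auto
  then have "\<bar>F A - F A'\<bar> \<le> d"
    using Lip[unfolded slice_Lipschitz_def, rule_format, of x "A - {x}" y] A' Suc(3) xy
    by (simp add: A'_def)
  moreover have "real (card (A - B)) * d = k * d + d"
    unfolding Suc(2)[symmetric] by (simp add: algebra_simps)
  ultimately show ?case using IH by linarith
qed

text \<open>Identity plus \<open>\<epsilon>\<close> times the generator in which each particle jumps
  to each empty site \<open>y\<close> at rate \<open>r y\<close>.\<close>

definition swap_step :: "('a \<Rightarrow> real) \<Rightarrow> 'a set \<Rightarrow> real \<Rightarrow> ('a set \<Rightarrow> real) \<Rightarrow> 'a set \<Rightarrow> real" where
  "swap_step r V \<epsilon> F A = F A + \<epsilon> * (\<Sum>x\<in>A. \<Sum>y\<in>V - A. r y * (F (insert y (A - {x})) - F A))"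

text \<open>A coupling argument in analytic form. The copies \<open>insert x T\<close> and
  \<open>insert y T\<close> share the particles \<open>T\<close> and the empty sites
  \<open>U\<close>. The two odd particles meet at rate \<open>S + r x + r y\<close>. A common
  particle \<open>c\<close> jumps to common empty sites in both copies together; it can also jump to
  \<open>y\<close> in the first copy and to \<open>x\<close> in the second, which leads to the same
  configuration, so the copies merge at the smaller of \<open>r x\<close> and \<open>r y\<close>.
  Every site of \<open>V\<close> thus contributes at least \<open>m\<close> to the merging
  rate.\<close>

lemma swap_step_diff_le:
  fixes r :: "'a \<Rightarrow> real" and m \<epsilon> d :: real
  assumes fin: "finite V" and m: "\<And>z. z \<in> V \<Longrightarrow> m \<le> r z" and "0 < m" and "0 \<le> \<epsilon>"
    and small: "\<epsilon> * (sum r V * (1 + card V)) \<le> 1"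
    and Lip: "slice_Lipschitz V N F d"
    and xT: "insert x T \<in> slice V N" and yT: "insert y T \<in> slice V N"
    and nin: "x \<notin> T" "y \<notin> T" and "x \<noteq> y"
  shows "swap_step r V \<epsilon> F (insert x T) - swap_step r V \<epsilon> F (insert y T) \<le> (1 - \<epsilon> * (card V * m)) * d"
proof -
  note Lip' = Lip[unfolded slice_Lipschitz_def, rule_format]
  define U where "U = V - T - {x, y}"
  define D where "D = F (insert x T) - F (insert y T)"
  define S where "S = sum r U"
  have TV: "T \<subseteq> V" "x \<in> V" "y \<in> V" using xT yT by (auto simp: slice_def)
  have finT: "finite T" and finU: "finite U" using TV fin by (auto simp: U_def intro: finite_subset)
  have U: "x \<notin> U" "y \<notin> U" and xU: "V - insert x T = insert y U" and yU: "V - insert y T = insert x U"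
    using TV nin \<open>x \<noteq> y\<close> by (auto simp: U_def)
  have cardT: "N = Suc (card T)" using xT finT nin by (simp add: slice_def)
  have rpos: "0 < r z" if "z \<in> V" for z using m[OF that] \<open>0 < m\<close> by simp
  have d: "D \<le> d" using Lip'[OF xT yT] nin by (simp add: D_def)
  have d0: "0 \<le> d" using Lip'[OF xT xT] nin by simp
  \<comment> \<open>Contribution of the jumps of the common particle \<open>c\<close>; subtracting
    \<open>D\<close> compares the discrepancy after a joint jump with the present one.\<close>
  define E where "E = (\<lambda>c. (\<Sum>z\<in>U. r z * (F (insert z (insert x (T - {c}))) - F (insert z (insert y (T - {c}))) - D))
     + r y * (F (insert y (insert x (T - {c}))) - F (insert x T))
     - r x * (F (insert y (insert x (T - {c}))) - F (insert y T)))"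
  have gen: "(\<Sum>c\<in>insert u T. \<Sum>z\<in>insert v U. r z * (F (insert z (insert u T - {c})) - F (insert u T))) =
      (\<Sum>z\<in>U. r z * (F (insert z T) - F (insert u T))) + r v * (F (insert v T) - F (insert u T)) +
      (\<Sum>c\<in>T. (\<Sum>z\<in>U. r z * (F (insert z (insert u (T - {c}))) - F (insert u T)))
         + r v * (F (insert v (insert u (T - {c}))) - F (insert u T)))"
    if "u \<notin> T" "v \<notin> U" for u v
  proof -
    have "insert u T - {c} = insert u (T - {c})" if "c \<in> T" for c using that \<open>u \<notin> T\<close> by auto
    then show ?thesis using that finT finU by (simp add: add.commute)
  qed
  have "(\<Sum>c\<in>insert x T. \<Sum>z\<in>V - insert x T. r z * (F (insert z (insert x T - {c})) - F (insert x T)))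
      - (\<Sum>c\<in>insert y T. \<Sum>z\<in>V - insert y T. r z * (F (insert z (insert y T - {c})) - F (insert y T)))
      = - (S + r x + r y) * D + (\<Sum>c\<in>T. E c)"
    unfolding xU yU gen[OF nin(1) U(2)] gen[OF nin(2) U(1)] E_def D_def S_def
    by (simp add: sum.distrib sum_subtractf sum_distrib_left sum_distrib_right algebra_simps insert_commute)
  then have diff: "swap_step r V \<epsilon> F (insert x T) - swap_step r V \<epsilon> F (insert y T) =
      D + \<epsilon> * (- (S + r x + r y) * D + (\<Sum>c\<in>T. E c))"
    by (simp add: swap_step_def D_def flip: right_diff_distrib)
  have Ebound: "E c \<le> (S + max (r x) (r y)) * (d - D) - m * d" if c: "c \<in> T" for c
  proof -
    have cV: "c \<in> V" "c \<noteq> x" "c \<noteq> y" using c TV nin by auto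
    have ins: "insert c (insert u (T - {c})) = insert u T" for u using c by auto
    have cardTc: "Suc (card (T - {c})) = card T" using c finT by (intro card_Suc_Diff1)
    have slice3: "insert u (insert v (T - {c})) \<in> slice V N"
      if "u \<in> V" "v \<in> V" "u \<noteq> v" "u \<notin> T - {c}" "v \<notin> T - {c}" for u v
      using that TV finT cardTc cardT by (auto simp: slice_def)
    have "F (insert z (insert x (T - {c}))) - F (insert z (insert y (T - {c}))) - D \<le> d - D" if "z \<in> U" for z
    proof -
      have z: "z \<in> V" "z \<notin> T" "z \<noteq> x" "z \<noteq> y" using that by (auto simp: U_def)
      show ?thesis
        using Lip'[of x "insert z (T - {c})" y] slice3[of x z] slice3[of y z] z TV nin \<open>x \<noteq> y\<close>
        by (simp add: insert_commute abs_le_iff)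
    qed
    then have 1: "(\<Sum>z\<in>U. r z * (F (insert z (insert x (T - {c}))) - F (insert z (insert y (T - {c}))) - D)) \<le> S * (d - D)"
      unfolding S_def sum_distrib_right using rpos
      by (intro sum_mono mult_left_mono) (auto simp: U_def intro: less_imp_le)
    define q where "q = F (insert y (insert x (T - {c})))"
    have q1: "F (insert x T) - q \<le> d"
      using Lip'[of y "insert x (T - {c})" c] slice3[of y x] xT TV nin \<open>x \<noteq> y\<close> cV
      unfolding ins q_def by (simp add: abs_le_iff)
    have q2: "q - F (insert y T) \<le> d"
      using Lip'[of x "insert y (T - {c})" c] slice3[of x y] yT TV nin \<open>x \<noteq> y\<close> cV
      unfolding ins q_def by (simp add: abs_le_iff insert_commute)
    \<comment> \<open>The two jumps to the configuration with value \<open>q\<close> are paired at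
      the smaller rate, where the copies merge. The surplus rate moves one copy only and leaves a
      single discrepancy, between \<open>c\<close> and \<open>y\<close> or between \<open>c\<close>
      and \<open>x\<close>, so \<open>q1\<close> or \<open>q2\<close> applies.\<close>
    have 2: "r y * (q - F (insert x T)) - r x * (q - F (insert y T)) \<le> max (r x) (r y) * (d - D) - m * d"
    proof (cases "r y \<le> r x")
      case True
      have "r y * (q - F (insert x T)) - r x * (q - F (insert y T)) = (r x - r y) * (F (insert x T) - q) - r x * D"
        by (simp add: D_def algebra_simps)
      also have "\<dots> \<le> (r x - r y) * d - r x * D"
        using q1 True by (simp add: mult_left_mono)
      also have "\<dots> \<le> r x * (d - D) - m * d"
        using mult_right_mono[OF m[OF TV(3)] d0] by (simp add: algebra_simps)
      finally show ?thesis using True by (simp add: max_def)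
    next
      case False
      have "r y * (q - F (insert x T)) - r x * (q - F (insert y T)) = (r y - r x) * (q - F (insert y T)) - r y * D"
        by (simp add: D_def algebra_simps)
      also have "\<dots> \<le> (r y - r x) * d - r y * D"
        using q2 False by (simp add: mult_left_mono)
      also have "\<dots> \<le> r y * (d - D) - m * d"
        using mult_right_mono[OF m[OF TV(2)] d0] by (simp add: algebra_simps)
      finally show ?thesis using False by (simp add: max_def)
    qed
    show ?thesis using 1 2 unfolding E_def q_def by (simp add: algebra_simps)
  qed
  \<comment> \<open>Total rate of the coupled pair; \<open>\<epsilon> * Q \<le> 1\<close>, shown
    below, lets the term with \<open>d - D\<close> be absorbed.\<close>
  define Q where "Q = S + r x + r y + card T * (S + max (r x) (r y))"
  have "(\<Sum>c\<in>T. E c) \<le> card T * ((S + max (r x) (r y)) * (d - D) - m * d)"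
    using sum_mono[of T E, OF Ebound] by simp
  moreover have "(card U + 2) * m * d \<le> (S + r x + r y) * d"
  proof -
    have "card U * m \<le> S"
      unfolding S_def using sum_mono[of U "\<lambda>_. m" r] m by (auto simp: U_def)
    then show ?thesis
      using m[OF TV(2)] m[OF TV(3)] d0 by (intro mult_right_mono) (auto simp: algebra_simps)
  qed
  moreover have "card V = card U + 2 + card T"
  proof -
    have "V = insert x (insert y (U \<union> T))" using TV by (auto simp: U_def)
    moreover have "card (U \<union> T) = card U + card T"
      using finT finU by (intro card_Un_disjoint) (auto simp: U_def)
    ultimately show ?thesis using finT finU nin U \<open>x \<noteq> y\<close> by simp
  qed
  ultimately have "- (S + r x + r y) * D + (\<Sum>c\<in>T. E c) \<le> Q * (d - D) - card V * m * d"
    by (simp add: Q_def algebra_simps)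
  then have "D + \<epsilon> * (- (S + r x + r y) * D + (\<Sum>c\<in>T. E c)) \<le> D + \<epsilon> * (Q * (d - D) - card V * m * d)"
    using \<open>0 \<le> \<epsilon>\<close> by (intro add_left_mono mult_left_mono)
  moreover have "\<epsilon> * Q * (d - D) \<le> 1 * (d - D)"
  proof (intro mult_right_mono)
    have R: "sum r V = S + r x + r y + sum r T"
    proof -
      have "V = insert x (insert y (U \<union> T))" using TV by (auto simp: U_def)
      moreover have "sum r (U \<union> T) = S + sum r T"
        unfolding S_def using finT finU by (intro sum.union_disjoint) (auto simp: U_def)
      ultimately show ?thesis using finT finU nin U \<open>x \<noteq> y\<close> by simp
    qed
    have "0 \<le> sum r T" using rpos TV by (intro sum_nonneg) (auto intro: less_imp_le)
    then have 1: "S + r x + r y \<le> sum r V" "S + max (r x) (r y) \<le> sum r V"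
      using R rpos[OF TV(2)] rpos[OF TV(3)] by auto
    have "0 \<le> sum r V" using rpos by (intro sum_nonneg) (auto intro: less_imp_le)
    then have "card T * (S + max (r x) (r y)) \<le> card V * sum r V"
      using 1 TV fin by (intro order_trans[OF mult_left_mono mult_right_mono]) (auto intro: card_mono)
    with 1 have "Q \<le> sum r V * (1 + card V)" by (simp add: Q_def algebra_simps)
    then have "\<epsilon> * Q \<le> \<epsilon> * (sum r V * (1 + card V))" using \<open>0 \<le> \<epsilon>\<close> by (rule mult_left_mono)
    then show "\<epsilon> * Q \<le> 1" using small by simp
  qed (use d in simp)
  ultimately show ?thesis unfolding diff by (simp add: algebra_simps)
qed

lemma slice_Lipschitz_swap_step:
  fixes r :: "'a \<Rightarrow> real" and m \<epsilon> d :: real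
  assumes "finite V" "\<And>z. z \<in> V \<Longrightarrow> m \<le> r z" "0 < m" "0 \<le> \<epsilon>"
    and small: "\<epsilon> * (sum r V * (1 + card V)) \<le> 1"
    and Lip: "slice_Lipschitz V N F d"
  shows "slice_Lipschitz V N (swap_step r V \<epsilon> F) ((1 - \<epsilon> * (card V * m)) * d)"
  unfolding slice_Lipschitz_def
proof (intro allI impI)
  fix T x y
  assume T: "insert x T \<in> slice V N" "insert y T \<in> slice V N" "x \<notin> T" "y \<notin> T"
  note step = swap_step_diff_le[OF assms(1,2,3,4) small Lip]
  have "0 \<le> d"
    using Lip[unfolded slice_Lipschitz_def, rule_format, OF T(1,1,3,3)] by simp
  moreover have "\<epsilon> * (card V * m) \<le> 1"
  proof -
    have "card V * m \<le> sum r V" using sum_mono[of V "\<lambda>_. m" r] assms(2) by simp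
    moreover have "0 \<le> sum r V"
      using assms(2,3) by (intro sum_nonneg) (meson order.strict_implies_order order.trans)
    then have "sum r V \<le> sum r V * (1 + card V)" by (simp add: algebra_simps)
    ultimately have "card V * m \<le> sum r V * (1 + card V)" by (rule order_trans)
    then have "\<epsilon> * (card V * m) \<le> \<epsilon> * (sum r V * (1 + card V))"
      using \<open>0 \<le> \<epsilon>\<close> by (rule mult_left_mono)
    with small show ?thesis by simp
  qed
  ultimately have "0 \<le> (1 - \<epsilon> * (card V * m)) * d" by simp
  then show "\<bar>swap_step r V \<epsilon> F (insert x T) - swap_step r V \<epsilon> F (insert y T)\<bar>
      \<le> (1 - \<epsilon> * (card V * m)) * d"
    using step[of x T y] step[of y T x] T by (cases "x = y") (auto simp: abs_le_iff)
qed

text \<open>The contraction bounds the form of \<open>swap_step\<close> at \<open>F\<close> by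
  \<open>\<rho>\<close> times the squared norm. By reversibility that form is the squared norm minus
  \<open>\<epsilon> / 2\<close> times the jump energy \<open>e\<close>, so \<open>\<epsilon>\<close>
  cancels and a gap \<open>card V * m\<close> independent of \<open>N\<close> remains.\<close>

lemma slice_Poincare:
  fixes r :: "'a \<Rightarrow> real" and m M :: real
  assumes fin: "finite V" and m: "\<And>z. z \<in> V \<Longrightarrow> m \<le> r z" and M: "\<And>z. z \<in> V \<Longrightarrow> r z \<le> M" and "0 < m"
    and supp: "\<And>A. card A \<noteq> N \<Longrightarrow> F A = 0"
    and mean0: "(\<Sum>A\<in>slice V N. prod r A * F A) = 0"
  shows "card V * m * (\<Sum>A\<in>slice V N. prod r A * (F A)\<^sup>2)
    \<le> M\<^sup>2 / 2 * (\<Sum>x\<in>V. \<Sum>y\<in>V. exchange_energy r V F x y)"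
proof -
  have rpos: "0 < r z" if "z \<in> V" for z using m[OF that] \<open>0 < m\<close> by simp
  have finS: "finite (slice V N)" using fin by (rule finite_slice)
  have wpos: "0 < prod r A" if "A \<in> slice V N" for A
    using that rpos by (intro prod_pos) (auto simp: slice_def)
  define R where "R = sum r V * (1 + card V)"
  have sum0: "0 \<le> sum r V" using rpos by (intro sum_nonneg) (auto intro: less_imp_le)
  have R: "card V * m \<le> R" "0 \<le> R"
  proof -
    have "card V * m \<le> sum r V" using sum_mono[of V "\<lambda>_. m" r] m by simp
    also have "\<dots> \<le> R" unfolding R_def using sum0 by (simp add: algebra_simps)
    finally show "card V * m \<le> R" .
    show "0 \<le> R" unfolding R_def using sum0 by simp
  qed
  \<comment> \<open>Small enough for the coupling bound and, as
    \<open>\<epsilon> * R \<le> 1/2\<close>, for \<open>\<rho> > 0\<close>; the summand 1 covers the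
    empty \<open>V\<close>.\<close>
  define \<epsilon> where "\<epsilon> = 1 / (2 * (R + 1))"
  define \<rho> where "\<rho> = 1 - \<epsilon> * (card V * m)"
  have \<epsilon>: "0 < \<epsilon>" using R by (simp add: \<epsilon>_def)
  have "\<epsilon> * R \<le> 1/2" using R by (simp add: \<epsilon>_def field_simps)
  then have small: "\<epsilon> * (sum r V * (1 + card V)) \<le> 1" by (simp add: R_def)
  have "\<epsilon> * (card V * m) \<le> \<epsilon> * R" using R \<epsilon> by (intro mult_left_mono) auto
  with \<open>\<epsilon> * R \<le> 1/2\<close> have \<rho>: "0 < \<rho>" by (simp add: \<rho>_def)
  let ?w = "prod r"
  let ?P = "swap_step r V \<epsilon>"
  have sw: "(\<Sum>A\<in>slice V N. ?w A * (\<Sum>x\<in>A. \<Sum>y\<in>V - A. r y * h A (insert y (A - {x})))) =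
      (\<Sum>(A, x, y)\<in>swaps V N. ?w A * r y * h A (insert y (A - {x})))" for h
  proof -
    have "(\<Sum>A\<in>slice V N. ?w A * (\<Sum>x\<in>A. \<Sum>y\<in>V - A. r y * h A (insert y (A - {x})))) =
      (\<Sum>A\<in>slice V N. \<Sum>(x, y)\<in>A \<times> (V - A). ?w A * r y * h A (insert y (A - {x})))"
      by (simp add: sum_distrib_left mult.assoc sum.cartesian_product case_prod_unfold)
    also have "\<dots> = (\<Sum>(A, x, y)\<in>swaps V N. ?w A * r y * h A (insert y (A - {x})))"
      unfolding swaps_def using fin finS
      by (subst sum.Sigma) (auto simp: slice_def intro: finite_subset)
    finally show ?thesis .
  qed
  have form: "(\<Sum>A\<in>slice V N. ?w A * (f A * ?P g A)) = (\<Sum>A\<in>slice V N. ?w A * (f A * g A)) +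
      \<epsilon> * ((\<Sum>(A, x, y)\<in>swaps V N. ?w A * r y * (f A * g (insert y (A - {x}))))
         - (\<Sum>(A, x, y)\<in>swaps V N. ?w A * r y * (f A * g A)))" for f g
  proof -
    have "(\<Sum>A\<in>slice V N. ?w A * (f A * ?P g A)) = (\<Sum>A\<in>slice V N. ?w A * (f A * g A)) +
       \<epsilon> * (\<Sum>A\<in>slice V N. ?w A * (\<Sum>x\<in>A. \<Sum>y\<in>V - A. r y * (f A * (g (insert y (A - {x})) - g A))))"
      by (simp add: swap_step_def sum.distrib sum_distrib_left sum_distrib_right algebra_simps)
    also have "(\<Sum>A\<in>slice V N. ?w A * (\<Sum>x\<in>A. \<Sum>y\<in>V - A. r y * (f A * (g (insert y (A - {x})) - g A))))
      = (\<Sum>(A, x, y)\<in>swaps V N. ?w A * r y * (f A * (g (insert y (A - {x})) - g A)))"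
      by (rule sw)
    also have "\<dots> = (\<Sum>(A, x, y)\<in>swaps V N. ?w A * r y * (f A * g (insert y (A - {x}))))
         - (\<Sum>(A, x, y)\<in>swaps V N. ?w A * r y * (f A * g A))"
      by (simp add: sum_subtractf[symmetric] case_prod_unfold algebra_simps)
    finally show ?thesis .
  qed
  have rev: "(\<Sum>(A, x, y)\<in>swaps V N. ?w A * r y * (f A * g (insert y (A - {x})))) =
    (\<Sum>(A, x, y)\<in>swaps V N. ?w A * r y * (g A * f (insert y (A - {x}))))" for f g
    using swaps_weighted_reverse[OF fin, where N = N and r = r and h = "\<lambda>A B. f A * g B"] by (simp add: mult.commute)
  have sym: "(\<Sum>A\<in>slice V N. ?w A * (f A * ?P g A)) = (\<Sum>A\<in>slice V N. ?w A * (?P f A * g A))" for f g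
    using form[of f g] form[of g f] rev[of f g] by (simp add: mult.commute)
  have mean: "(\<Sum>A\<in>slice V N. ?w A * ?P f A) = (\<Sum>A\<in>slice V N. ?w A * f A)" for f
    using form[of "\<lambda>_. 1" f] rev[of "\<lambda>_. 1" f] by simp
  \<comment> \<open>Nonnegativity of \<open>d\<close> is carried along: on a slice without nonempty
    sets \<open>slice_Lipschitz\<close> is vacuous and would admit a negative
    \<open>d\<close>.\<close>
  have osc: "\<bar>f A - f B\<bar> \<le> real (card V) * d"
    if Lip: "slice_Lipschitz V N f d \<and> 0 \<le> d" and AB: "A \<in> slice V N" "B \<in> slice V N" for f d A B
  proof -
    have "card (A - B) \<le> card V" using fin AB by (intro card_mono) (auto simp: slice_def)
    then have "real (card (A - B)) * d \<le> real (card V) * d" using Lip by (intro mult_right_mono) auto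
    then show ?thesis using slice_Lipschitz_oscillation[OF fin _ _ AB, of f d] Lip by simp
  qed
  have contract: "slice_Lipschitz V N (?P f) (\<rho> * d) \<and> 0 \<le> \<rho> * d"
    if "slice_Lipschitz V N f d \<and> 0 \<le> d" for f d
    using slice_Lipschitz_swap_step[OF fin m \<open>0 < m\<close> _ small, of N f d] that \<epsilon> \<rho> by (simp add: \<rho>_def)
  \<comment> \<open>Any Lipschitz constant will do, since the log-convexity argument discards
    it.\<close>
  have Lip: "slice_Lipschitz V N F (2 * (\<Sum>A\<in>slice V N. \<bar>F A\<bar>)) \<and> 0 \<le> 2 * (\<Sum>A\<in>slice V N. \<bar>F A\<bar>)"
  proof -
    have "\<bar>F A\<bar> \<le> (\<Sum>A\<in>slice V N. \<bar>F A\<bar>)" if "A \<in> slice V N" for A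
      using that finS by (intro member_le_sum) auto
    then have "\<bar>F A - F B\<bar> \<le> 2 * (\<Sum>A\<in>slice V N. \<bar>F A\<bar>)" if "A \<in> slice V N" "B \<in> slice V N" for A B
      using that by (smt (verit))
    then show ?thesis by (auto simp: slice_Lipschitz_def intro!: sum_nonneg)
  qed
  have gap: "(\<Sum>A\<in>slice V N. ?w A * (F A * ?P F A)) \<le> \<rho> * (\<Sum>A\<in>slice V N. ?w A * (F A)\<^sup>2)"
    by (rule reversible_contraction[where Lip = "\<lambda>f d. slice_Lipschitz V N f d \<and> 0 \<le> d",
          OF finS wpos \<rho> sym mean contract osc Lip mean0])
  \<comment> \<open>Both diagonal sums in the expanded square agree by reversibility, so
    \<open>e\<close> is twice the diagonal sum minus twice the cross sum.\<close>
  define e where "e = (\<Sum>(A, x, y)\<in>swaps V N. ?w A * r y * (F (insert y (A - {x})) - F A)\<^sup>2)"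
  have "e = (\<Sum>(A, x, y)\<in>swaps V N. ?w A * r y * ((F (insert y (A - {x})))\<^sup>2))
     + (\<Sum>(A, x, y)\<in>swaps V N. ?w A * r y * (F A)\<^sup>2)
     - 2 * (\<Sum>(A, x, y)\<in>swaps V N. ?w A * r y * (F A * F (insert y (A - {x}))))"
    unfolding e_def sum_distrib_left
    by (simp add: sum_subtractf[symmetric] sum.distrib[symmetric] case_prod_unfold power2_eq_square algebra_simps)
  moreover have "(\<Sum>(A, x, y)\<in>swaps V N. ?w A * r y * ((F (insert y (A - {x})))\<^sup>2))
     = (\<Sum>(A, x, y)\<in>swaps V N. ?w A * r y * (F A)\<^sup>2)"
    using rev[of "\<lambda>A. (F A)\<^sup>2" "\<lambda>_. 1"] by simp
  ultimately have "(\<Sum>(A, x, y)\<in>swaps V N. ?w A * r y * (F A * F (insert y (A - {x}))))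
     - (\<Sum>(A, x, y)\<in>swaps V N. ?w A * r y * (F A)\<^sup>2) = - (e / 2)"
    by linarith
  then have "(\<Sum>A\<in>slice V N. ?w A * (F A * ?P F A)) = (\<Sum>A\<in>slice V N. ?w A * (F A)\<^sup>2) - \<epsilon> * (e / 2)"
    using form[of F F, folded power2_eq_square] by simp
  with gap have "\<epsilon> * (card V * m * (\<Sum>A\<in>slice V N. ?w A * (F A)\<^sup>2)) \<le> \<epsilon> * (e / 2)"
    by (simp add: \<rho>_def algebra_simps)
  then have "card V * m * (\<Sum>A\<in>slice V N. ?w A * (F A)\<^sup>2) \<le> e / 2" using \<epsilon> by simp
  also have "e = (\<Sum>x\<in>V. \<Sum>y\<in>V. r x * r y * exchange_energy r V F x y)"
    unfolding e_def by (rule sum_swaps_by_pairs[OF fin supp])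
  also have "\<dots> \<le> (\<Sum>x\<in>V. \<Sum>y\<in>V. M * M * exchange_energy r V F x y)"
  proof (intro sum_mono mult_right_mono)
    fix x y assume "x \<in> V" "y \<in> V"
    then show "r x * r y \<le> M * M"
      using rpos[of x] rpos[of y] M[of x] M[of y] by (intro mult_mono) auto
    show "0 \<le> exchange_energy r V F x y"
      unfolding exchange_energy_def using rpos
      by (intro sum_nonneg mult_nonneg_nonneg prod_nonneg) (auto intro: less_imp_le)
  qed
  also have "\<dots> = M\<^sup>2 * (\<Sum>x\<in>V. \<Sum>y\<in>V. exchange_energy r V F x y)"
    by (simp add: sum_distrib_left power2_eq_square)
  finally show ?thesis by simp
qed

section \<open>Exchange energies along paths\<close>

lemma exchange_energy_nonneg:
  assumes "\<And>z. z \<in> V \<Longrightarrow> 0 \<le> r z"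
  shows "0 \<le> exchange_energy r V F x y"
  unfolding exchange_energy_def using assms
  by (intro sum_nonneg mult_nonneg_nonneg prod_nonneg) auto

lemma exchange_energy_refl [simp]: "exchange_energy r V F x x = 0"
  by (simp add: exchange_energy_def)

lemma exchange_energy_commute: "exchange_energy r V F x y = exchange_energy r V F y x"
  unfolding exchange_energy_def by (simp add: insert_commute power2_commute)

lemma exchange_energy_cong:
  assumes "\<And>z. z \<in> V - {x, y} \<Longrightarrow> r z = s z"
  shows "exchange_energy r V F x y = exchange_energy s V F x y"
  unfolding exchange_energy_def using assms
  by (intro sum.cong refl arg_cong2[of _ _ _ _ "(*)"] prod.cong) auto

text \<open>A site occurs at most once in \<open>prod r T\<close>, so changing the weight of the
  single site \<open>u\<close> costs one factor \<open>c\<close>, whatever the number of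
  particles.\<close>

lemma exchange_energy_mono:
  assumes "finite V" "\<And>z. z \<in> V \<Longrightarrow> 0 \<le> s z" "1 \<le> c"
    and "u \<notin> V \<or> 0 \<le> r u \<and> r u \<le> c * s u" and "\<And>z. z \<in> V - {u} \<Longrightarrow> r z = s z"
  shows "exchange_energy r V F x y \<le> c * exchange_energy s V F x y"
proof -
  have "prod r T \<le> c * prod s T" if T: "T \<subseteq> V" for T
  proof -
    have finT: "finite T" using T assms by (auto intro: finite_subset)
    have nonneg: "0 \<le> prod s U" if "U \<subseteq> T" for U using that T assms by (intro prod_nonneg) auto
    show ?thesis
    proof (cases "u \<in> T")
      case True
      have "prod r T = r u * prod s (T - {u})"
        using True finT T assms(5) by (simp add: prod.remove[of T u]) (auto intro!: prod.cong)
      also have "\<dots> \<le> c * s u * prod s (T - {u})"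
        using assms True T nonneg by (intro mult_right_mono) auto
      also have "\<dots> = c * prod s T" using True finT by (simp add: prod.remove[of T u])
      finally show ?thesis .
    next
      case False
      then have "prod r T = prod s T" using T assms by (intro prod.cong) auto
      then show ?thesis using nonneg[of T] assms by (simp add: mult_le_cancel_right1)
    qed
  qed
  then show ?thesis
    unfolding exchange_energy_def sum_distrib_left mult.assoc[symmetric]
    by (intro sum_mono mult_right_mono) auto
qed

lemma exchange_energy_fun_upd_le:
  assumes "finite V" "\<And>z. z \<in> V \<Longrightarrow> m \<le> r z" "0 < m" "\<And>z. z \<in> V \<Longrightarrow> r z \<le> M" "m \<le> M"
  shows "exchange_energy (r(a := M, b := M)) V F x y \<le> (M / m)\<^sup>2 * exchange_energy r V F x y"
proof -
  have pos: "0 \<le> r z" "M \<le> M / m * r z" if "z \<in> V" for z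
    using assms(2)[OF that] assms(3,5) by (auto simp: field_simps intro: order_trans[of 0 m] mult_left_mono)
  have M: "1 \<le> M / m" "0 \<le> M" using assms by auto
  then have M2: "M \<le> M / m * M" using mult_right_mono[OF M] by simp
  have "exchange_energy (r(a := M, b := M)) V F x y \<le> M / m * exchange_energy (r(a := M)) V F x y"
    using assms pos M M2 by (intro exchange_energy_mono[where u = b]) auto
  also have "\<dots> \<le> M / m * (M / m * exchange_energy r V F x y)"
    using assms pos M by (intro mult_left_mono exchange_energy_mono[where u = a]) auto
  finally show ?thesis by (simp add: power2_eq_square mult_ac)
qed

text \<open>Cauchy--Schwarz for two terms, with an explicit square as the defect. Later
  \<open>p\<close> and \<open>q\<close> are the lengths of two pieces of a path.\<close>

lemma square_add_le_weighted:
  fixes a b p q :: real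
  assumes "0 < p" "0 < q"
  shows "(a + b)\<^sup>2 \<le> (p + q) * (a\<^sup>2 / p + b\<^sup>2 / q)"
proof -
  have "(p + q) * (a\<^sup>2 / p + b\<^sup>2 / q) - (a + b)\<^sup>2 = (q * a - p * b)\<^sup>2 / (p * q)"
    using assms by (simp add: field_simps power2_eq_square)
  also have "\<dots> \<ge> 0" using assms by simp
  finally show ?thesis by simp
qed

lemma sum_Pow_insert:
  fixes h :: "'a set \<Rightarrow> real"
  assumes "finite W" "z \<notin> W"
  shows "(\<Sum>T\<in>Pow (insert z W). h T) = (\<Sum>T\<in>Pow W. h T) + (\<Sum>T\<in>Pow W. h (insert z T))"
proof -
  have "inj_on (insert z) (Pow W)" using assms by (auto simp: inj_on_def)
  then show ?thesis
    using assms unfolding Pow_insert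
    by (subst sum.union_disjoint) (auto simp: sum.reindex)
qed

text \<open>A particle moving past \<open>z\<close> takes different routes according to whether
  \<open>z\<close> is empty or occupied; the two sums separate these cases.\<close>

lemma exchange_energy_split:
  fixes r :: "'a \<Rightarrow> real"
  assumes "finite V" "x \<noteq> y" "z \<in> V" "z \<noteq> x" "z \<noteq> y"
  shows "exchange_energy r V F x y =
    (\<Sum>T\<in>Pow (V - {x, y, z}). prod r T * (F (insert x T) - F (insert y T))\<^sup>2) +
    (\<Sum>T\<in>Pow (V - {x, y, z}). r z * prod r T * (F (insert x (insert z T)) - F (insert y (insert z T)))\<^sup>2)"
proof -
  have V: "V - {x, y} = insert z (V - {x, y, z})" using assms by auto
  have "z \<notin> T" "finite T" if "T \<subseteq> V - {x, y, z}" for T using that assms by (auto intro: finite_subset)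
  then show ?thesis unfolding exchange_energy_def V
    using assms by (subst sum_Pow_insert) (auto intro!: sum.cong arg_cong2[of _ _ _ _ "(+)"])
qed

text \<open>Moving a particle from \<open>x\<close> to \<open>y\<close> past a particle at \<open>z\<close>: first the particle at \<open>z\<close>
  moves to \<open>y\<close>, then the one at \<open>x\<close> moves to \<open>z\<close>. The condition on \<open>r z\<close> ensures that the
  intermediate configuration does not lose weight.\<close>

lemma exchange_energy_triangle:
  fixes r :: "'a \<Rightarrow> real"
  assumes fin: "finite V" and nonneg: "\<And>v. v \<in> V \<Longrightarrow> 0 \<le> r v"
    and V: "x \<in> V" "y \<in> V" "z \<in> V" and dist: "x \<noteq> y" "z \<noteq> x" "z \<noteq> y"
    and le: "r z \<le> r x" "r z \<le> r y" and pq: "0 < p" "0 < q"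
  shows "exchange_energy r V F x y \<le> (p + q) * (exchange_energy r V F x z / p + exchange_energy r V F z y / q)"
proof -
  let ?W = "Pow (V - {x, y, z})"
  have W: "{x, z, y} = {x, y, z}" "{z, y, x} = {x, y, z}" by auto
  let ?a = "\<lambda>T. prod r T * (F (insert x T) - F (insert z T))\<^sup>2"
  let ?b = "\<lambda>T. prod r T * (F (insert z T) - F (insert y T))\<^sup>2"
  let ?a' = "\<lambda>T. r y * prod r T * (F (insert x (insert y T)) - F (insert z (insert y T)))\<^sup>2"
  let ?b' = "\<lambda>T. r x * prod r T * (F (insert z (insert x T)) - F (insert y (insert x T)))\<^sup>2"
  have w: "0 \<le> prod r T" if "T \<in> ?W" for T using that nonneg by (intro prod_nonneg) auto
  \<comment> \<open>With \<open>z\<close> empty the particle passes through \<open>z\<close>, and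
    the weight \<open>prod r T\<close> stays the same.\<close>
  have 1: "prod r T * (F (insert x T) - F (insert y T))\<^sup>2 \<le> (p + q) * (?a T / p + ?b T / q)" if "T \<in> ?W" for T
    using mult_left_mono[OF square_add_le_weighted[OF pq, of "F (insert x T) - F (insert z T)" "F (insert z T) - F (insert y T)"] w[OF that]]
    using pq by (simp add: algebra_simps add_divide_distrib)
  have 2: "r z * prod r T * (F (insert x (insert z T)) - F (insert y (insert z T)))\<^sup>2 \<le> (p + q) * (?a' T / p + ?b' T / q)"
    if T: "T \<in> ?W" for T
  proof -
    let ?u = "F (insert x (insert y T)) - F (insert z (insert y T))"
    let ?v = "F (insert z (insert x T)) - F (insert y (insert x T))"
    have "F (insert x (insert z T)) - F (insert y (insert z T)) = ?u + ?v"
      by (simp add: insert_commute)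
    then have "r z * prod r T * (F (insert x (insert z T)) - F (insert y (insert z T)))\<^sup>2
        \<le> r z * prod r T * ((p + q) * (?u\<^sup>2 / p + ?v\<^sup>2 / q))"
      using square_add_le_weighted[OF pq, of ?u ?v] w[OF T] nonneg[OF V(3)]
      by (intro mult_left_mono) auto
    also have "\<dots> = prod r T * (p + q) * (r z * ?u\<^sup>2 / p + r z * ?v\<^sup>2 / q)"
      by (simp add: algebra_simps)
    also have "\<dots> \<le> prod r T * (p + q) * (r y * ?u\<^sup>2 / p + r x * ?v\<^sup>2 / q)"
      using le pq w[OF T] by (intro mult_left_mono add_mono divide_right_mono mult_right_mono) auto
    also have "\<dots> = (p + q) * (?a' T / p + ?b' T / q)" by (simp add: algebra_simps)
    finally show ?thesis .
  qed
  have "exchange_energy r V F x y \<le> (\<Sum>T\<in>?W. (p + q) * (?a T / p + ?b T / q)) + (\<Sum>T\<in>?W. (p + q) * (?a' T / p + ?b' T / q))"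
    unfolding exchange_energy_split[OF fin dist(1) V(3) dist(2,3)]
    using 1 2 by (intro add_mono sum_mono) auto
  also have "\<dots> = (p + q) * ((sum ?a ?W + sum ?a' ?W) / p + (sum ?b ?W + sum ?b' ?W) / q)"
  proof -
    have "(\<Sum>T\<in>?W. (p + q) * (u T / p + v T / q)) = (p + q) * (sum u ?W / p + sum v ?W / q)" for u v
      by (simp only: sum_distrib_left[symmetric] sum.distrib sum_divide_distrib[symmetric])
    then show ?thesis by (simp only:) (simp add: add_divide_distrib distrib_left)
  qed
  \<comment> \<open>For the leg between \<open>x\<close> and \<open>z\<close> the third site is
    \<open>y\<close>; for the leg between \<open>z\<close> and \<open>y\<close> it is
    \<open>x\<close>.\<close>
  also have "sum ?a ?W + sum ?a' ?W = exchange_energy r V F x z"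
    using exchange_energy_split[OF fin, of x z y r F] V dist W by simp
  also have "sum ?b ?W + sum ?b' ?W = exchange_energy r V F z y"
    using exchange_energy_split[OF fin, of z y x r F] V dist W by simp
  finally show ?thesis .
qed

text \<open>Induction on the length, splitting at a heaviest interior site: the interior of each
  half is then no heavier than the ends of that half, so the hypothesis is inherited.\<close>

lemma exchange_energy_monotone_path:
  fixes r :: "'a \<Rightarrow> real" and z :: "nat \<Rightarrow> 'a"
  assumes fin: "finite V" and nonneg: "\<And>v. v \<in> V \<Longrightarrow> 0 \<le> r v"
    and "i < j" "inj_on z {i..j}" "z ` {i..j} \<subseteq> V"
    and "\<And>k. i < k \<Longrightarrow> k < j \<Longrightarrow> r (z k) \<le> r (z i) \<and> r (z k) \<le> r (z j)"
  shows "exchange_energy r V F (z i) (z j) \<le>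
    real (j - i) * (\<Sum>k=i..<j. exchange_energy r V F (z k) (z (Suc k)))"
  using assms(3-6)
proof (induction "j - i" arbitrary: i j rule: less_induct)
  case less
  let ?E = "exchange_energy r V F"
  show ?case
  proof (cases "j = Suc i")
    case True
    then show ?thesis by simp
  next
    case False
    define S where "S = {i<..<j}"
    have "Suc i \<in> S" using False less.prems(1) by (auto simp: S_def)
    then have "finite S" "S \<noteq> {}" by (auto simp: S_def)
    then have "Max ((\<lambda>k. r (z k)) ` S) \<in> (\<lambda>k. r (z k)) ` S" by (intro Max_in) auto
    then obtain l where l: "l \<in> S" "Max ((\<lambda>k. r (z k)) ` S) = r (z l)" by auto
    then have max: "r (z k) \<le> r (z l)" if "k \<in> S" for k
      using that \<open>finite S\<close> by (metis Max_ge finite_imageI imageI)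
    have il: "i < l" "l < j" using l(1) by (auto simp: S_def)
    have left: "?E (z i) (z l) \<le> real (l - i) * (\<Sum>k=i..<l. ?E (z k) (z (Suc k)))"
      using il less.prems max
      by (intro less.hyps) (auto simp: S_def intro: inj_on_subset)
    have right: "?E (z l) (z j) \<le> real (j - l) * (\<Sum>k=l..<j. ?E (z k) (z (Suc k)))"
      using il less.prems max
      by (intro less.hyps) (auto simp: S_def intro: inj_on_subset)
    have "z i \<noteq> z j" "z l \<noteq> z i" "z l \<noteq> z j"
      using inj_on_eq_iff[OF less.prems(2)] il by auto
    \<comment> \<open>With the lengths of the halves as \<open>p\<close> and \<open>q\<close>, the
      factors in \<open>left\<close> and \<open>right\<close> cancel the denominators; the lengths
      add up and no constant accumulates.\<close>
    then have "?E (z i) (z j) \<le> (real (l - i) + real (j - l)) * (?E (z i) (z l) / real (l - i) + ?E (z l) (z j) / real (j - l))"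
      using less.prems il by (intro exchange_energy_triangle[OF fin nonneg]) auto
    also have "\<dots> \<le> (real (l - i) + real (j - l)) *
        ((\<Sum>k=i..<l. ?E (z k) (z (Suc k))) + (\<Sum>k=l..<j. ?E (z k) (z (Suc k))))"
      using left right il by (intro mult_left_mono add_mono) (auto simp: divide_le_eq mult.commute)
    also have "\<dots> = real (j - i) * (\<Sum>k=i..<j. ?E (z k) (z (Suc k)))"
      using il by (simp add: sum.atLeastLessThan_concat of_nat_diff)
    finally show ?thesis .
  qed
qed

text \<open>An exchange energy does not depend on the weights at its two sites, so these may be raised
  to the maximum, which makes the previous lemma applicable to every path.\<close>

lemma exchange_energy_path:
  fixes r :: "'a \<Rightarrow> real" and z :: "nat \<Rightarrow> 'a"
  assumes fin: "finite V" and m: "\<And>v. v \<in> V \<Longrightarrow> m \<le> r v" "0 < m"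
    and M: "\<And>v. v \<in> V \<Longrightarrow> r v \<le> M" "m \<le> M"
    and z: "i < j" "inj_on z {i..j}" "z ` {i..j} \<subseteq> V"
  shows "exchange_energy r V F (z i) (z j) \<le>
    (M / m)\<^sup>2 * real (j - i) * (\<Sum>k=i..<j. exchange_energy r V F (z k) (z (Suc k)))"
proof -
  define s where "s = r(z i := M, z j := M)"
  have nonneg: "0 \<le> s v" if "v \<in> V" for v using that m M by (force simp: s_def)
  have inner: "s (z k) \<le> s (z i) \<and> s (z k) \<le> s (z j)" if "i < k" "k < j" for k
  proof -
    have "z k \<in> V" using that z by auto
    then show ?thesis using M by (auto simp: s_def)
  qed
  have "exchange_energy r V F (z i) (z j) = exchange_energy s V F (z i) (z j)"
    by (rule exchange_energy_cong) (simp add: s_def)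
  also have "\<dots> \<le> real (j - i) * (\<Sum>k=i..<j. exchange_energy s V F (z k) (z (Suc k)))"
    by (rule exchange_energy_monotone_path[OF fin nonneg z inner])
  \<comment> \<open>Returning to the original weights costs one factor \<open>M / m\<close> for each
    of the two raised sites, paid once for the whole path.\<close>
  also have "\<dots> \<le> real (j - i) * (\<Sum>k=i..<j. (M / m)\<^sup>2 * exchange_energy r V F (z k) (z (Suc k)))"
    unfolding s_def using fin m M
    by (intro mult_left_mono sum_mono exchange_energy_fun_upd_le) auto
  finally show ?thesis by (simp add: sum_distrib_left mult_ac)
qed

text \<open>The path bound for the two bonds through \<open>z\<close>: the 2 is the length, and
  \<open>(M / m)\<^sup>2\<close> pays for weights in arbitrary order. Coinciding sites are covered
  since the constant is at least 1.\<close>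

lemma exchange_energy_quasi_triangle:
  fixes r :: "'a \<Rightarrow> real"
  assumes fin: "finite V" and m: "\<And>v. v \<in> V \<Longrightarrow> m \<le> r v" "0 < m"
    and M: "\<And>v. v \<in> V \<Longrightarrow> r v \<le> M" "m \<le> M"
    and V: "x \<in> V" "y \<in> V" "z \<in> V"
  shows "exchange_energy r V F x y \<le>
    2 * (M / m)\<^sup>2 * (exchange_energy r V F x z + exchange_energy r V F z y)"
proof -
  let ?E = "exchange_energy r V F"
  have E0: "0 \<le> ?E u v" for u v
    using m by (intro exchange_energy_nonneg) (meson less_imp_le order.trans)
  have "1 \<le> (M / m)\<^sup>2" using m(2) M(2) by (intro one_le_power) simp
  then have c: "1 \<le> 2 * (M / m)\<^sup>2" by simp
  consider "x = y" | "z = x" | "z = y" | "x \<noteq> y" "z \<noteq> x" "z \<noteq> y" by blast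
  then show ?thesis
  proof cases
    case 1
    then show ?thesis using E0 c by simp
  next
    case 2
    then show ?thesis using mult_right_mono[OF c E0[of x y]] by simp
  next
    case 3
    then show ?thesis using mult_right_mono[OF c E0[of x y]] by simp
  next
    case 4
    let ?z = "\<lambda>k::nat. if k = 0 then x else if k = 1 then z else y"
    have "{0..2} = {0, 1, 2::nat}" by auto
    then have "inj_on ?z {0..2}" "?z ` {0..2} \<subseteq> V" using 4 V by (auto simp: inj_on_def)
    from exchange_energy_path[OF fin m M _ this, where F = F]
    show ?thesis by (simp add: numeral_2_eq_2 mult_ac)
  qed
qed

section \<open>Comparing all exchanges in a box with nearest-neighbour exchanges\<close>

text \<open>Waypoints of the route from \<open>x\<close> to \<open>u\<close> that changes one
  coordinate after another; \<open>I\<close> holds the coordinates already changed.\<close>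

definition mix_coords :: "'d set \<Rightarrow> int ^ 'd \<Rightarrow> int ^ 'd \<Rightarrow> int ^ 'd" where
  "mix_coords I x u = (\<chi> i. if i \<in> I then u $ i else x $ i)"

definition set_coord :: "int ^ 'd \<Rightarrow> 'd \<Rightarrow> int \<Rightarrow> int ^ 'd" where
  "set_coord x k t = (\<chi> i. if i = k then t else x $ i)"

lemma mix_coords_nth [simp]: "mix_coords I x u $ i = (if i \<in> I then u $ i else x $ i)"
  by (simp add: mix_coords_def)

lemma set_coord_nth [simp]: "set_coord x k t $ i = (if i = k then t else x $ i)"
  by (simp add: set_coord_def)

lemma mix_coords_in_box: "x \<in> lattice_box y L \<Longrightarrow> u \<in> lattice_box y L \<Longrightarrow> mix_coords I x u \<in> lattice_box y L"
  by (simp add: lattice_box_def)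

lemma set_coord_in_box:
  "x \<in> lattice_box y L \<Longrightarrow> t < L \<Longrightarrow> set_coord x k (y $ k + int t) \<in> lattice_box y L"
  by (simp add: lattice_box_def)

text \<open>Exchanging the \<open>k\<close>-th coordinate, measured from the corner
  \<open>y\<close>, with the parameter \<open>t\<close> is an involution of the pairs; afterwards
  the summand no longer depends on \<open>t\<close>.\<close>

lemma sum_lattice_box_set_coord:
  fixes G :: "int ^ 'd \<Rightarrow> real"
  shows "(\<Sum>x\<in>lattice_box y L. \<Sum>t<L. G (set_coord x k (y $ k + int t))) = real L * (\<Sum>x\<in>lattice_box y L. G x)"
proof -
  let ?B = "lattice_box y L"
  let ?j = "\<lambda>(x, t). (set_coord x k (y $ k + int t), nat (x $ k - y $ k))"
  have j: "?j (?j s) = s" "?j s \<in> ?B \<times> {..<L}" if "s \<in> ?B \<times> {..<L}" for s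
  proof -
    obtain x t where s: "s = (x, t)" "x \<in> ?B" "t < L" using \<open>s \<in> _\<close> by auto
    then have "0 \<le> x $ k - y $ k" "x $ k - y $ k < int L" by (auto simp: lattice_box_def)
    with s show "?j (?j s) = s" "?j s \<in> ?B \<times> {..<L}"
      by (auto simp: vec_eq_iff set_coord_in_box)
  qed
  have "(\<Sum>x\<in>?B. \<Sum>t<L. G (set_coord x k (y $ k + int t))) = (\<Sum>(x, t)\<in>?B \<times> {..<L}. G (set_coord x k (y $ k + int t)))"
    by (rule sum.cartesian_product)
  also have "\<dots> = (\<Sum>(x, t)\<in>?B \<times> {..<L}. G x)"
    by (rule sum.reindex_bij_witness[where i = ?j and j = ?j]) (use j in auto)
  also have "\<dots> = real L * (\<Sum>x\<in>?B. G x)"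
    by (simp add: sum.cartesian_product[symmetric] sum_distrib_left)
  finally show ?thesis .
qed

text \<open>Exchanging the coordinates in \<open>I\<close> between \<open>x\<close> and
  \<open>u\<close> is an involution of the pairs in the box. It lets a later leg of a route be
  summed as if it were the first.\<close>

lemma sum_mix_coords:
  fixes G :: "int ^ 'd \<Rightarrow> int ^ 'd \<Rightarrow> real"
  shows "(\<Sum>x\<in>lattice_box y L. \<Sum>u\<in>lattice_box y L. G (mix_coords I x u) (mix_coords I u x)) =
    (\<Sum>x\<in>lattice_box y L. \<Sum>u\<in>lattice_box y L. G x u)"
proof -
  let ?B = "lattice_box y L"
  let ?j = "\<lambda>(x, u). (mix_coords I x u, mix_coords I u x)"
  have j: "?j (?j s) = s" "?j s \<in> ?B \<times> ?B" if "s \<in> ?B \<times> ?B" for s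
    using that by (auto simp: mix_coords_in_box vec_eq_iff)
  have "(\<Sum>(x, u)\<in>?B \<times> ?B. G (mix_coords I x u) (mix_coords I u x)) = (\<Sum>(x, u)\<in>?B \<times> ?B. G x u)"
    by (rule sum.reindex_bij_witness[where i = ?j and j = ?j]) (use j in auto)
  then show ?thesis by (simp add: sum.cartesian_product)
qed

text \<open>The route from \<open>x\<close> to \<open>u\<close> changes one coordinate at a time;
  each costs a factor of the quasi-triangle inequality, hence the power \<open>CARD('d)\<close>. On
  a line the path bound gives one factor \<open>L\<close>. A bond is charged from the
  \<open>L\<close> sites of its line and for \<open>card (lattice_box y L)\<close> targets, which
  gives the other factors.\<close>

lemma sum_exchange_energy_lattice_box_le:
  fixes r :: "int ^ 'd \<Rightarrow> real" and y :: "int ^ 'd" and m M :: real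
  assumes m: "\<And>v. v \<in> lattice_box y L \<Longrightarrow> m \<le> r v" "0 < m"
    and M: "\<And>v. v \<in> lattice_box y L \<Longrightarrow> r v \<le> M" "m \<le> M"
  shows "(\<Sum>x\<in>lattice_box y L. \<Sum>u\<in>lattice_box y L. exchange_energy r (lattice_box y L) F x u) \<le>
    (2 * (M / m)\<^sup>2) ^ CARD('d) * (M / m)\<^sup>2 * card (lattice_box y L) * (real L)\<^sup>2 *
    (\<Sum>(x, u) | x \<in> lattice_box y L \<and> u \<in> lattice_box y L \<and> nearest_neighbours x u.
       exchange_energy r (lattice_box y L) F x u)"
proof -
  define B where "B = lattice_box y L"
  define E where "E = exchange_energy r B F"
  \<comment> \<open>Energy of the bond from \<open>u\<close> in direction \<open>k\<close>, set to 0
    when the bond leaves the box, so that sums may run over a whole line.\<close>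
  define H where "H k u = (if u + axis k 1 \<in> B then E u (u + axis k 1) else 0)" for k u
  have finB: "finite B" by (simp add: B_def finite_lattice_box)
  have E0: "0 \<le> E u v" for u v
    unfolding E_def B_def using m by (intro exchange_energy_nonneg) (meson less_imp_le order.trans)
  have H0: "0 \<le> H k u" for k u by (simp add: H_def E0)
  define c where "c = (M / m)\<^sup>2"
  have c: "1 \<le> c" unfolding c_def using m(2) M(2) by (intro one_le_power) auto
  have path: "E (set_coord x k (y $ k + int a)) (set_coord x k (y $ k + int b)) \<le>
      c * L * (\<Sum>t<L. H k (set_coord x k (y $ k + int t)))"
    if "x \<in> B" "a < b" "b < L" for x k a b
  proof -
    let ?z = "\<lambda>t. set_coord x k (y $ k + int t)"
    have inj: "inj_on ?z {a..b}" by (auto simp: inj_on_def vec_eq_iff split: if_splits)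
    have inB: "?z t \<in> B" if "t < L" for t using that \<open>x \<in> B\<close> by (simp add: B_def set_coord_in_box)
    have step: "?z (Suc t) = ?z t + axis k 1" for t by (simp add: vec_eq_iff axis_def)
    have "E (?z a) (?z b) \<le> c * real (b - a) * (\<Sum>t=a..<b. E (?z t) (?z (Suc t)))"
      unfolding E_def c_def using inB that m M inj
      by (intro exchange_energy_path[OF finB]) (auto simp: B_def)
    also have "(\<Sum>t=a..<b. E (?z t) (?z (Suc t))) = (\<Sum>t=a..<b. H k (?z t))"
    proof (intro sum.cong refl)
      fix t assume "t \<in> {a..<b}"
      then have "?z (Suc t) \<in> B" using that by (intro inB) simp
      then show "E (?z t) (?z (Suc t)) = H k (?z t)" unfolding step by (simp add: H_def)
    qed
    \<comment> \<open>Enlarging the segment to the full line makes the bound independent of its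
      ends.\<close>
    also have "c * real (b - a) * \<dots> \<le> c * L * (\<Sum>t<L. H k (?z t))"
      using c that H0 by (intro mult_mono sum_mono2 sum_nonneg) auto
    finally show ?thesis .
  qed
  \<comment> \<open>Totals over all pairs, because re-indexing by \<open>sum_mix_coords\<close> is
    available only after summation.\<close>
  define S where "S I = (\<Sum>x\<in>B. \<Sum>u\<in>B. E x (mix_coords I x u))" for I
  have line: "E x (mix_coords {k} x u) \<le> c * L * (\<Sum>t<L. H k (set_coord x k (y $ k + int t)))"
    if "x \<in> B" "u \<in> B" for x u k
  proof -
    define a where "a = nat (x $ k - y $ k)"
    define b where "b = nat (u $ k - y $ k)"
    have ab: "a < L" "b < L" "int a = x $ k - y $ k" "int b = u $ k - y $ k"
      using that by (auto simp: B_def lattice_box_def a_def b_def nat_less_iff)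
    have x: "x = set_coord x k (y $ k + int a)" "mix_coords {k} x u = set_coord x k (y $ k + int b)"
      using ab by (auto simp: vec_eq_iff)
    consider "a < b" | "b < a" | "a = b" by linarith
    then show ?thesis
    proof cases
      case 1
      then show ?thesis using path[OF that(1) 1 ab(2), of k] x by simp
    next
      case 2
      have "E (mix_coords {k} x u) x \<le> c * L * (\<Sum>t<L. H k (set_coord x k (y $ k + int t)))"
        using path[OF that(1) 2 ab(1), of k] x by simp
      then show ?thesis by (simp add: E_def exchange_energy_commute)
    next
      case 3
      then have "E x (mix_coords {k} x u) = 0" using x by (simp add: E_def)
      then show ?thesis using c H0 by (simp add: sum_nonneg)
    qed
  qed
  have single: "S {k} \<le> c * card B * (real L)\<^sup>2 * (\<Sum>x\<in>B. H k x)" for k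
  proof -
    have "S {k} \<le> (\<Sum>x\<in>B. \<Sum>u\<in>B. c * L * (\<Sum>t<L. H k (set_coord x k (y $ k + int t))))"
      unfolding S_def using line by (intro sum_mono)
    also have "\<dots> = c * card B * L * (\<Sum>x\<in>B. \<Sum>t<L. H k (set_coord x k (y $ k + int t)))"
      by (simp add: sum_distrib_left mult_ac)
    also have "\<dots> = c * card B * (real L)\<^sup>2 * (\<Sum>x\<in>B. H k x)"
      unfolding B_def sum_lattice_box_set_coord by (simp add: power2_eq_square)
    finally show ?thesis .
  qed
  have insert: "S (insert k I) \<le> 2 * c * (S I + S {k})" if "k \<notin> I" for k I
  proof -
    have "S (insert k I) \<le> (\<Sum>x\<in>B. \<Sum>u\<in>B. 2 * c * (E x (mix_coords I x u) +
        E (mix_coords I x u) (mix_coords {k} (mix_coords I x u) (mix_coords I u x))))"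
      unfolding S_def
    proof (intro sum_mono)
      fix x u assume xu: "x \<in> B" "u \<in> B"
      \<comment> \<open>As \<open>k\<close> is not in \<open>I\<close>, the exchanged pair keeps the
        \<open>k\<close>-th coordinates of \<open>x\<close> and \<open>u\<close>. The last leg is
        thus a one-coordinate change for that pair, and its total is \<open>S {k}\<close>.\<close>
      have "mix_coords (insert k I) x u = mix_coords {k} (mix_coords I x u) (mix_coords I u x)"
        using that by (auto simp: vec_eq_iff)
      then show "E x (mix_coords (insert k I) x u) \<le> 2 * c * (E x (mix_coords I x u) +
          E (mix_coords I x u) (mix_coords {k} (mix_coords I x u) (mix_coords I u x)))"
        using xu m M unfolding E_def c_def
        by (simp only:) (intro exchange_energy_quasi_triangle[OF finB], auto simp: B_def intro!: mix_coords_in_box)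
    qed
    also have "\<dots> = 2 * c * (S I + (\<Sum>x\<in>B. \<Sum>u\<in>B. E (mix_coords I x u) (mix_coords {k} (mix_coords I x u) (mix_coords I u x))))"
      by (simp add: S_def sum.distrib flip: sum_distrib_left)
    also have "(\<Sum>x\<in>B. \<Sum>u\<in>B. E (mix_coords I x u) (mix_coords {k} (mix_coords I x u) (mix_coords I u x))) = S {k}"
      unfolding S_def B_def by (rule sum_mix_coords[where G = "\<lambda>x u. E x (mix_coords {k} x u)"])
    finally show ?thesis .
  qed
  have S0: "0 \<le> S I" for I unfolding S_def using E0 by (intro sum_nonneg)
  have S: "S I \<le> (2 * c) ^ card I * (\<Sum>k\<in>I. S {k})" if "finite I" for I
    using that
  proof (induction I rule: finite_induct)
    case empty
    have "mix_coords {} x u = x" for x u :: "int ^ 'd" by (simp add: vec_eq_iff)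
    then show ?case by (simp add: S_def E_def)
  next
    case (insert k I)
    have "S (insert k I) \<le> 2 * c * (S I + S {k})" using insert by (intro \<open>k \<notin> I \<Longrightarrow> _\<close>)
    also have "\<dots> \<le> 2 * c * ((2 * c) ^ card I * (\<Sum>k\<in>I. S {k}) + (2 * c) ^ card I * S {k})"
    proof (intro mult_left_mono add_mono)
      have "1 \<le> (2 * c) ^ card I" using c by (intro one_le_power) auto
      then show "S {k} \<le> (2 * c) ^ card I * S {k}" using mult_right_mono[OF _ S0, of 1] by simp
    qed (use insert c in auto)
    also have "\<dots> = (2 * c) ^ card (insert k I) * (\<Sum>k\<in>insert k I. S {k})"
      using insert by (simp add: algebra_simps)
    finally show ?case .
  qed
  \<comment> \<open>The left side has only bonds in positive directions, the right side both
    orientations.\<close>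
  have bonds: "(\<Sum>k\<in>UNIV. \<Sum>x\<in>B. H k x) \<le> (\<Sum>(x, u) | x \<in> B \<and> u \<in> B \<and> nearest_neighbours x u. E x u)"
  proof -
    let ?X = "{s \<in> UNIV \<times> B. snd s + axis (fst s) 1 \<in> B}"
    let ?g = "\<lambda>s :: 'd \<times> (int ^ 'd). (snd s, snd s + axis (fst s) 1)"
    have "(\<Sum>k\<in>UNIV. \<Sum>x\<in>B. H k x) = (\<Sum>s\<in>UNIV \<times> B. H (fst s) (snd s))"
      by (simp add: sum.cartesian_product case_prod_unfold)
    also have "\<dots> = (\<Sum>s\<in>?X. H (fst s) (snd s))"
      using finB by (intro sum.mono_neutral_right) (auto simp: H_def)
    also have "\<dots> = (\<Sum>s\<in>?X. case ?g s of (x, u) \<Rightarrow> E x u)"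
      by (intro sum.cong) (auto simp: H_def)
    also have "\<dots> = (\<Sum>(x, u)\<in>?g ` ?X. E x u)"
      by (subst sum.reindex) (auto simp: inj_on_def axis_eq_axis)
    also have "\<dots> \<le> (\<Sum>(x, u) | x \<in> B \<and> u \<in> B \<and> nearest_neighbours x u. E x u)"
    proof (intro sum_mono2)
      have "{(x, u). x \<in> B \<and> u \<in> B \<and> nearest_neighbours x u} \<subseteq> B \<times> B" by auto
      then show "finite {(x, u). x \<in> B \<and> u \<in> B \<and> nearest_neighbours x u}"
        by (rule finite_subset) (use finB in auto)
      show "?g ` ?X \<subseteq> {(x, u). x \<in> B \<and> u \<in> B \<and> nearest_neighbours x u}"
        by (auto simp: nearest_neighbours_def axis_def if_distrib cong: if_cong)
    qed (use E0 in auto)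
    finally show ?thesis .
  qed
  have "(\<Sum>x\<in>B. \<Sum>u\<in>B. E x u) = S UNIV"
  proof -
    have "mix_coords UNIV x u = u" for x u :: "int ^ 'd" by (simp add: vec_eq_iff)
    then show ?thesis by (simp add: S_def)
  qed
  also have "\<dots> \<le> (2 * c) ^ CARD('d) * (\<Sum>k\<in>UNIV. S {k})" by (rule S) simp
  also have "\<dots> \<le> (2 * c) ^ CARD('d) * (\<Sum>k\<in>UNIV. c * card B * (real L)\<^sup>2 * (\<Sum>x\<in>B. H k x))"
    using c single by (intro mult_left_mono sum_mono) auto
  also have "\<dots> = (2 * c) ^ CARD('d) * c * card B * (real L)\<^sup>2 * (\<Sum>k\<in>UNIV. \<Sum>x\<in>B. H k x)"
    by (simp add: mult.assoc flip: sum_distrib_left)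
  also have "\<dots> \<le> (2 * c) ^ CARD('d) * c * card B * (real L)\<^sup>2 *
      (\<Sum>(x, u) | x \<in> B \<and> u \<in> B \<and> nearest_neighbours x u. E x u)"
    using c bonds by (intro mult_left_mono) auto
  finally show ?thesis unfolding c_def E_def B_def .
qed

section \<open>The canonical measure and its Dirichlet form in terms of particle sets\<close>

text \<open>The factor \<open>1 / (1 + exp (\<alpha> x))\<close> occurs at every site, occupied or
  not, so its product is independent of \<open>A\<close>. Conditioning divides by the probability of
  the level, and one constant serves all \<open>g\<close>.\<close>

lemma canonical_expectation:
  assumes fin: "finite \<Lambda>" and N: "N \<le> card \<Lambda>"
  obtains c where "0 < c" and "\<And>g :: (int ^ 'd \<Rightarrow> bool) \<Rightarrow> real. measure_pmf.expectation (canonical \<alpha> \<Lambda> N) g =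
    c * (\<Sum>A\<in>slice \<Lambda> N. prod (\<lambda>x. exp (\<alpha> x)) A * g (\<lambda>x. x \<in> A))"
proof
  let ?p = "\<lambda>x. exp (\<alpha> x) / (1 + exp (\<alpha> x))"
  let ?C = "{\<eta>. num_particles \<Lambda> \<eta> = N}"
  let ?\<chi> = "\<lambda>A x. x \<in> A"
  define Z where "Z = measure (bernoulli_field \<alpha> \<Lambda>) ?C"
  define q where "q = (\<Prod>x\<in>\<Lambda>. 1 / (1 + exp (\<alpha> x)))"
  note ne = canonical_conditioning_nonempty[OF fin N, of \<alpha>]
  have Z: "0 < Z" unfolding Z_def using ne by (auto intro: measure_pmf_posI)
  have q: "0 < q" unfolding q_def by (intro prod_pos) (auto intro: add_pos_pos)
  show "0 < q / Z" using Z q by simp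
  have num: "num_particles \<Lambda> \<eta> = card {x \<in> \<Lambda>. \<eta> x}" for \<eta>
    using fin by (simp add: num_particles_def of_bool_def sum.If_cases Int_def)
  have pmf: "pmf (canonical \<alpha> \<Lambda> N) (?\<chi> A) = q / Z * prod (\<lambda>x. exp (\<alpha> x)) A" if A: "A \<in> slice \<Lambda> N" for A
  proof -
    have AL: "A \<subseteq> \<Lambda>" "card A = N" using A by (auto simp: slice_def)
    then have eq: "{x \<in> \<Lambda>. x \<in> A} = A" by auto
    have p: "0 \<le> ?p x" "?p x \<le> 1" "1 - ?p x = 1 / (1 + exp (\<alpha> x))" for x
    proof -
      have "0 < 1 + exp (\<alpha> x)" by (simp add: add_pos_pos)
      then show "0 \<le> ?p x" "?p x \<le> 1" "1 - ?p x = 1 / (1 + exp (\<alpha> x))"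
        by (simp_all add: divide_simps)
    qed
    have "pmf (bernoulli_field \<alpha> \<Lambda>) (?\<chi> A) = (\<Prod>x\<in>\<Lambda>. pmf (bernoulli_pmf (?p x)) (x \<in> A))"
      unfolding bernoulli_field_def using AL by (intro pmf_Pi') (auto simp: fin)
    also have "\<dots> = (\<Prod>x\<in>\<Lambda>. 1 / (1 + exp (\<alpha> x)) * (if x \<in> A then exp (\<alpha> x) else 1))"
    proof (intro prod.cong refl)
      fix x show "pmf (bernoulli_pmf (?p x)) (x \<in> A) = 1 / (1 + exp (\<alpha> x)) * (if x \<in> A then exp (\<alpha> x) else 1)"
        using p[of x] by (cases "x \<in> A") simp_all
    qed
    also have "\<dots> = q * prod (\<lambda>x. exp (\<alpha> x)) A"
      using AL fin unfolding q_def prod.distrib by (simp add: prod.If_cases Int_absorb1)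
    finally show ?thesis
      unfolding canonical_def pmf_cond[OF ne] using AL eq by (simp add: num Z_def)
  qed
  show "measure_pmf.expectation (canonical \<alpha> \<Lambda> N) g =
    q / Z * (\<Sum>A\<in>slice \<Lambda> N. prod (\<lambda>x. exp (\<alpha> x)) A * g (?\<chi> A))" for g :: "(int ^ 'd \<Rightarrow> bool) \<Rightarrow> real"
  proof -
    have "\<eta> \<in> ?\<chi> ` slice \<Lambda> N" if "\<eta> \<in> set_pmf (canonical \<alpha> \<Lambda> N)" for \<eta>
    proof -
      have \<eta>: "\<forall>x. x \<notin> \<Lambda> \<longrightarrow> \<not> \<eta> x" "card {x \<in> \<Lambda>. \<eta> x} = N"
        using that unfolding canonical_def set_cond_pmf[OF ne] set_bernoulli_field[OF fin] by (auto simp: num)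
      then have "\<eta> = ?\<chi> {x \<in> \<Lambda>. \<eta> x}" by auto
      moreover have "{x \<in> \<Lambda>. \<eta> x} \<in> slice \<Lambda> N" using \<eta> by (auto simp: slice_def)
      ultimately show ?thesis by (rule image_eqI)
    qed
    then have "measure_pmf.expectation (canonical \<alpha> \<Lambda> N) g =
        (\<Sum>\<eta>\<in>?\<chi> ` slice \<Lambda> N. g \<eta> * pmf (canonical \<alpha> \<Lambda> N) \<eta>)"
      using finite_slice[OF fin] by (intro integral_measure_pmf_real) auto
    also have "\<dots> = (\<Sum>A\<in>slice \<Lambda> N. g (?\<chi> A) * pmf (canonical \<alpha> \<Lambda> N) (?\<chi> A))"
      by (subst sum.reindex) (auto simp: inj_on_def fun_eq_iff)
    also have "\<dots> = q / Z * (\<Sum>A\<in>slice \<Lambda> N. prod (\<lambda>x. exp (\<alpha> x)) A * g (?\<chi> A))"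
      unfolding sum_distrib_left by (intro sum.cong refl) (simp add: pmf mult_ac)
    finally show ?thesis .
  qed
qed

text \<open>Adding a particle at \<open>x\<close> to \<open>T\<close> gives the configuration before
  the exchange, and \<open>m \<le> r x\<close> accounts for its weight. These configurations form
  part of the slice, and the other terms are nonnegative. The shift \<open>a\<close> cancels in
  differences; the cutoff at level \<open>N\<close> leaves \<open>card T + 1 = N\<close>.\<close>

lemma exchange_energy_le_bond_term:
  fixes r :: "'a \<Rightarrow> real" and f :: "('a \<Rightarrow> bool) \<Rightarrow> real"
  assumes fin: "finite V" and m: "\<And>v. v \<in> V \<Longrightarrow> m \<le> r v" "0 < m" and V: "x \<in> V" "y \<in> V" "x \<noteq> y"
  shows "m * exchange_energy r V (\<lambda>A. if card A = N then f (\<lambda>v. v \<in> A) - a else 0) x y \<le>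
    (\<Sum>A\<in>slice V N. prod r A * (f (exchange x y (\<lambda>v. v \<in> A)) - f (\<lambda>v. v \<in> A))\<^sup>2)"
proof -
  let ?F = "\<lambda>A. if card A = N then f (\<lambda>v. v \<in> A) - a else 0"
  let ?X = "{T \<in> Pow (V - {x, y}). card T + 1 = N}"
  let ?h = "\<lambda>A. prod r A * (f (exchange x y (\<lambda>v. v \<in> A)) - f (\<lambda>v. v \<in> A))\<^sup>2"
  have rpos: "0 < r v" if "v \<in> V" for v using m(1)[OF that] m(2) by simp
  have T: "finite T" "x \<notin> T" "y \<notin> T" "T \<subseteq> V" if "T \<in> Pow (V - {x, y})" for T
    using that fin by (auto intro: finite_subset)
  have "m * exchange_energy r V ?F x y = (\<Sum>T\<in>Pow (V - {x, y}). m * (prod r T * (?F (insert x T) - ?F (insert y T))\<^sup>2))"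
    by (simp add: exchange_energy_def sum_distrib_left)
  also have "\<dots> = (\<Sum>T\<in>?X. m * (prod r T * (?F (insert x T) - ?F (insert y T))\<^sup>2))"
  proof (rule sum.mono_neutral_right)
    show "\<forall>T\<in>Pow (V - {x, y}) - ?X. m * (prod r T * (?F (insert x T) - ?F (insert y T))\<^sup>2) = 0"
    proof
      fix T assume "T \<in> Pow (V - {x, y}) - ?X"
      then have "finite T" "x \<notin> T" "y \<notin> T" "card T + 1 \<noteq> N" using T by auto
      then show "m * (prod r T * (?F (insert x T) - ?F (insert y T))\<^sup>2) = 0" by simp
    qed
  qed (use fin in auto)
  also have "\<dots> \<le> (\<Sum>T\<in>?X. ?h (insert x T))"
  proof (intro sum_mono)
    fix T assume "T \<in> ?X"
    then have T': "finite T" "x \<notin> T" "y \<notin> T" "T \<subseteq> V" "card T + 1 = N" using T by auto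
    have "exchange x y (\<lambda>v. v \<in> insert x T) = (\<lambda>v. v \<in> insert y T)"
      using T' V by (auto simp: exchange_def fun_eq_iff)
    moreover have "m * prod r T \<le> prod r (insert x T)"
    proof -
      have "0 \<le> prod r T" using T' rpos by (intro prod_nonneg) (auto intro: less_imp_le)
      then show ?thesis using T' m(1)[OF V(1)] by (simp add: mult_right_mono)
    qed
    ultimately show "m * (prod r T * (?F (insert x T) - ?F (insert y T))\<^sup>2) \<le> ?h (insert x T)"
      using T' mult_right_mono[of "m * prod r T" "prod r (insert x T)" "(f (\<lambda>v. v \<in> insert y T) - f (\<lambda>v. v \<in> insert x T))\<^sup>2"]
      by (simp add: power2_commute mult.assoc)
  qed
  also have "\<dots> = (\<Sum>A\<in>insert x ` ?X. ?h A)"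
    using T by (subst sum.reindex) (auto simp: inj_on_def)
  also have "\<dots> \<le> (\<Sum>A\<in>slice V N. ?h A)"
  proof (intro sum_mono2 finite_slice fin)
    show "insert x ` ?X \<subseteq> slice V N" using T V by (auto simp: slice_def)
    show "0 \<le> ?h A" if "A \<in> slice V N - insert x ` ?X" for A
      using that rpos by (intro mult_nonneg_nonneg prod_nonneg) (auto simp: slice_def intro: less_imp_le)
  qed
  finally show ?thesis .
qed

theorem theorem3:
  fixes K :: real
  assumes "K > 0"
  shows "\<exists>C::real. \<forall>(\<alpha> :: int ^ 'd \<Rightarrow> real) (y :: int ^ 'd) (L::nat) (N::nat)
            (f :: (int ^ 'd \<Rightarrow> bool) \<Rightarrow> real).
          (\<forall>x. - K \<le> \<alpha> x \<and> \<alpha> x \<le> K) \<longrightarrow> L \<ge> 1 \<longrightarrow> N \<le> L ^ CARD('d) \<longrightarrow>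
          measure_pmf.expectation (canonical \<alpha> (lattice_box y L) N)
            (\<lambda>\<eta>. (f \<eta> - measure_pmf.expectation (canonical \<alpha> (lattice_box y L) N) f)\<^sup>2)
          \<le> C * (real L)\<^sup>2 * kawasaki_form \<alpha> (lattice_box y L) N f"
proof -
  define m M where "m = exp (- K)" and "M = exp K"
  have mM: "0 < m" "m \<le> M" using assms by (auto simp: m_def M_def)
  define c where "c = (2 * (M / m)\<^sup>2) ^ CARD('d) * (M / m)\<^sup>2"
  have c0: "0 \<le> c" by (simp add: c_def)
  \<comment> \<open>\<open>M\<^sup>2 / 2\<close> and one \<open>1 / m\<close> come from the
    long-range Poincare inequality, \<open>c\<close> from the comparison in the box, the other
    \<open>1 / m\<close> from passing back to the Kawasaki form.\<close>
  define C where "C = M\<^sup>2 * c / (2 * m\<^sup>2)"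
  show ?thesis
  proof (intro exI[of _ C] allI impI)
    fix \<alpha> :: "int ^ 'd \<Rightarrow> real" and y :: "int ^ 'd" and L N :: nat and f :: "(int ^ 'd \<Rightarrow> bool) \<Rightarrow> real"
    assume K: "\<forall>x. - K \<le> \<alpha> x \<and> \<alpha> x \<le> K" and L: "L \<ge> 1" and N: "N \<le> L ^ CARD('d)"
    define B where "B = lattice_box y L"
    have finB: "finite B" and cardB: "card B = L ^ CARD('d)"
      by (simp_all add: B_def finite_lattice_box card_lattice_box)
    define r where "r = (\<lambda>x. exp (\<alpha> x))"
    have r: "m \<le> r v" "r v \<le> M" for v using K by (auto simp: r_def m_def M_def)
    obtain s where s: "0 < s" and E: "\<And>g :: (int ^ 'd \<Rightarrow> bool) \<Rightarrow> real.
        measure_pmf.expectation (canonical \<alpha> B N) g = s * (\<Sum>A\<in>slice B N. prod r A * g (\<lambda>x. x \<in> A))"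
      using canonical_expectation[OF finB, of N \<alpha>] N cardB unfolding r_def by auto
    define a where "a = measure_pmf.expectation (canonical \<alpha> B N) f"
    \<comment> \<open>The centred \<open>f\<close>, set to 0 at other particle numbers because
      exchange energies range over sets \<open>T\<close> of all sizes.\<close>
    define F where "F = (\<lambda>A. if card A = N then f (\<lambda>x. x \<in> A) - a else 0)"
    have F: "F A = f (\<lambda>x. x \<in> A) - a" if "A \<in> slice B N" for A
      using that by (simp add: F_def slice_def)
    let ?P = "{(x, u). x \<in> B \<and> u \<in> B \<and> nearest_neighbours x u}"
    let ?h = "\<lambda>A. \<Sum>(x, u)\<in>?P. (f (exchange x u (\<lambda>x. x \<in> A)) - f (\<lambda>x. x \<in> A))\<^sup>2"
    let ?bonds = "\<Sum>(x, u)\<in>?P. exchange_energy r B F x u"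
    \<comment> \<open>Testing with the constant 1 gives the normalisation, which makes
      \<open>F\<close> centred for the weights.\<close>
    have "s * (\<Sum>A\<in>slice B N. prod r A) = 1" using E[of "\<lambda>_. 1"] by simp
    then have "s * (\<Sum>A\<in>slice B N. prod r A * (f (\<lambda>x. x \<in> A) - a)) = 0"
      using E[of f] by (simp add: a_def right_diff_distrib sum_subtractf flip: sum_distrib_right mult.assoc)
    then have "(\<Sum>A\<in>slice B N. prod r A * F A) = 0" using s by (simp add: F)
    then have "card B * m * (\<Sum>A\<in>slice B N. prod r A * (F A)\<^sup>2)
        \<le> M\<^sup>2 / 2 * (\<Sum>x\<in>B. \<Sum>u\<in>B. exchange_energy r B F x u)"
      using mM r by (intro slice_Poincare[OF finB]) (auto simp: F_def)
    also have "\<dots> \<le> M\<^sup>2 / 2 * (c * card B * (real L)\<^sup>2 * ?bonds)"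
      unfolding B_def c_def using mM r by (intro mult_left_mono sum_exchange_energy_lattice_box_le) auto
    finally have "card B * (m * (\<Sum>A\<in>slice B N. prod r A * (F A)\<^sup>2)) \<le> card B * (M\<^sup>2 / 2 * c * (real L)\<^sup>2 * ?bonds)"
      by (simp add: mult_ac)
    \<comment> \<open>The gap of order \<open>card B\<close> cancels the number of targets in the
      box comparison, leaving only the square of \<open>L\<close>; \<open>card B\<close> is positive
      since \<open>L \<ge> 1\<close>.\<close>
    then have "m * (\<Sum>A\<in>slice B N. prod r A * (F A)\<^sup>2) \<le> M\<^sup>2 / 2 * c * (real L)\<^sup>2 * ?bonds"
      using L cardB by simp
    \<comment> \<open>The second factor \<open>m\<close> is the one that
      \<open>exchange_energy_le_bond_term\<close> consumes.\<close>
    then have "m * (m * (\<Sum>A\<in>slice B N. prod r A * (F A)\<^sup>2)) \<le> m * (M\<^sup>2 / 2 * c * (real L)\<^sup>2 * ?bonds)"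
      using mM by (intro mult_left_mono) auto
    also have "\<dots> = M\<^sup>2 / 2 * c * (real L)\<^sup>2 * (\<Sum>(x, u)\<in>?P. m * exchange_energy r B F x u)"
      by (simp add: sum_distrib_left case_prod_unfold mult_ac)
    also have "\<dots> \<le> M\<^sup>2 / 2 * c * (real L)\<^sup>2 * (\<Sum>(x, u)\<in>?P. \<Sum>A\<in>slice B N.
        prod r A * (f (exchange x u (\<lambda>x. x \<in> A)) - f (\<lambda>x. x \<in> A))\<^sup>2)"
    proof (intro mult_left_mono sum_mono)
      fix p assume p: "p \<in> ?P"
      then have "fst p \<noteq> snd p" by (auto simp: nearest_neighbours_def)
      with p show "(case p of (x, u) \<Rightarrow> m * exchange_energy r B F x u) \<le>
          (case p of (x, u) \<Rightarrow> \<Sum>A\<in>slice B N. prod r A * (f (exchange x u (\<lambda>x. x \<in> A)) - f (\<lambda>x. x \<in> A))\<^sup>2)"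
        unfolding F_def using exchange_energy_le_bond_term[OF finB r(1) mM(1)] by auto
    qed (use c0 in auto)
    also have "\<dots> = M\<^sup>2 / 2 * c * (real L)\<^sup>2 * (\<Sum>A\<in>slice B N. prod r A * ?h A)"
      unfolding case_prod_unfold by (subst sum.swap) (simp add: sum_distrib_left)
    finally have main: "(\<Sum>A\<in>slice B N. prod r A * (F A)\<^sup>2) \<le> C * (real L)\<^sup>2 * (\<Sum>A\<in>slice B N. prod r A * ?h A)"
      using mM by (simp add: C_def field_simps power2_eq_square)
    have "measure_pmf.expectation (canonical \<alpha> B N) (\<lambda>\<eta>. (f \<eta> - a)\<^sup>2) = s * (\<Sum>A\<in>slice B N. prod r A * (F A)\<^sup>2)"
      unfolding E by (simp add: F)
    also have "\<dots> \<le> s * (C * (real L)\<^sup>2 * (\<Sum>A\<in>slice B N. prod r A * ?h A))"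
      using main s by (intro mult_left_mono) auto
    also have "\<dots> = C * (real L)\<^sup>2 * kawasaki_form \<alpha> B N f"
      unfolding kawasaki_form_def E by (simp add: mult_ac)
    finally show "measure_pmf.expectation (canonical \<alpha> (lattice_box y L) N)
        (\<lambda>\<eta>. (f \<eta> - measure_pmf.expectation (canonical \<alpha> (lattice_box y L) N) f)\<^sup>2)
        \<le> C * (real L)\<^sup>2 * kawasaki_form \<alpha> (lattice_box y L) N f"
      by (simp add: a_def B_def)
  qed
qed

end
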